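(* Let $X$ be a complex manifold, $D\subset X$ a simple normal crossings divisor, $f:(X,D)\to(X,D)$ a strict logarithmic self-map, and $(E,\Phi)$ an $f$-linearised holomorphic vector bundle. Let $p\in D$ be an isolated fixed point of $f$ lying on exactly $k$ branches of $D$. If $p$ is normally non-resonant, then $$\operatorname{Ind}_{p,D}^{\mathrm{bdry}}(f,E,\Phi;-1)=0.$$ More precisely, the polynomial $\operatorname{Ind}_{p,D}^{\mathrm{bdry}}(f,E,\Phi;y)\in\mathbb C[y]$ is divisible by $(1+y)^k$.
   Context: Strict logarithmic self-map: holomorphic $f:X\to X$ with $f^{-1}\mathcal I_{D_i}\cdot\mathcal O_X=\mathcal I_{D_i}$ for every irreducible component $D_i$ of $D$. At $p$ choose adapted coordinates $(z_1,\ldots,z_k,w_1,\ldots,w_m)$ centred at $p$ with $D=\{z_1\cdots z_k=0\}$ and $f^*z_i=z_ia_i(z,w)$ with $a_i$ units. The point $p$ is normally non-resonant if $\det(1-\mathrm d_Nf_p)=\prod_{i=1}^k(1-a_i(0,0))\neq0$. $A_{f,p}=\mathcal O_{X,p}/(x_1-f_1,\ldots,x_n-f_n)$ (local coordinates $x$ centred at $p$, $f_i=f^*x_i$, $n=\dim X$), and $\lambda_{f,p}:A_{f,p}\to\mathbb C$ is the Grothendieck residue functional $[h]\mapsto\operatorname{Res}_p\left[\frac{h\,\mathrm dx_1\wedge\cdots\wedge \mathrm dx_n}{x_1-f_1,\ldots,x_n-f_n}\right]$, extended coefficientwise to polynomials in $y$. $\Phi:f^*E\to E$ is a bundle morphism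 and $\tau_{\Phi,p}\in A_{f,p}$ is the class of the trace of its matrix in a local frame. $J_f^{\log}$ is the endomorphism of $\Omega_X^1(\log D)$ restricted to the fixed-point scheme of $f$ induced by pull-back of logarithmic forms ($f^*(\mathrm dz_i/z_i)=\mathrm dz_i/z_i+\mathrm da_i/a_i$). The boundary index is $\operatorname{Ind}_{p,D}^{\mathrm{bdry}}(f,E,\Phi;y)=\lambda_{f,p}\bigl(\tau_{\Phi,p}\det(1+yJ_f^{\log})\bigr)$. *)

theory Defs
  imports "HOL-Analysis.Analysis" "HOL-Computational_Algebra.Polynomial"
begin

section \<open>Complex manifolds\<close>

text \<open>
  The space is a whole Hausdorff type, modelled on \<open>complex ^ 'n\<close>; a chart is a pair of an open set and a
  coordinate map, whose values outside that set are irrelevant. Second countability is not required.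
\<close>

text \<open>A complex gradient \<open>g\<close> makes the real Frechet derivative complex linear.\<close>

definition holo_fun :: "(complex ^ 'n \<Rightarrow> complex) \<Rightarrow> (complex ^ 'n) set \<Rightarrow> bool" where
  "holo_fun F V \<longleftrightarrow>
     open V \<and> (\<forall>v\<in>V. \<exists>g :: complex ^ 'n. (F has_derivative (\<lambda>w. \<Sum>i\<in>UNIV. g $ i * w $ i)) (at v))"

type_synonym ('a, 'n) atlas = "('a set \<times> ('a \<Rightarrow> complex ^ 'n)) set"

definition topological_chart :: "'a::t2_space set \<Rightarrow> ('a \<Rightarrow> complex ^ 'n) \<Rightarrow> bool" where
  "topological_chart U z \<longleftrightarrow> open U \<and> open (z ` U) \<and> homeomorphism U (z ` U) z (inv_into U z)"

definition holo_transition ::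
    "'a::t2_space set \<Rightarrow> ('a \<Rightarrow> complex ^ 'n) \<Rightarrow> 'a set \<Rightarrow> ('a \<Rightarrow> complex ^ 'n) \<Rightarrow> bool" where
  "holo_transition U z V w \<longleftrightarrow> (\<forall>i. holo_fun (\<lambda>v. w (inv_into U z v) $ i) (z ` (U \<inter> V)))"

text \<open>Membership in the maximal atlas determined by \<open>A\<close>.\<close>

definition holo_chart ::
    "('a::t2_space, 'n::finite) atlas \<Rightarrow> 'a set \<Rightarrow> ('a \<Rightarrow> complex ^ 'n) \<Rightarrow> bool" where
  "holo_chart A U z \<longleftrightarrow> topological_chart U z \<and>
     (\<forall>(V, w)\<in>A. holo_transition U z V w \<and> holo_transition V w U z)"

definition complex_manifold :: "('a::t2_space, 'n::finite) atlas \<Rightarrow> bool" where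
  "complex_manifold A \<longleftrightarrow> (\<Union>(U, z)\<in>A. U) = UNIV \<and> (\<forall>(U, z)\<in>A. holo_chart A U z)"

definition centred_chart ::
    "('a::t2_space, 'n::finite) atlas \<Rightarrow> 'a \<Rightarrow> 'a set \<Rightarrow> ('a \<Rightarrow> complex ^ 'n) \<Rightarrow> bool" where
  "centred_chart A p U z \<longleftrightarrow> holo_chart A U z \<and> p \<in> U \<and> z p = 0"

definition hol_on :: "('a::t2_space, 'n::finite) atlas \<Rightarrow> 'a set \<Rightarrow> ('a \<Rightarrow> complex) \<Rightarrow> bool" where
  "hol_on A W h \<longleftrightarrow> open W \<and> (\<forall>(U, z)\<in>A. holo_fun (\<lambda>v. h (inv_into U z v)) (z ` (U \<inter> W)))"

text \<open>
  \<open>hol_at A p h\<close>: the function \<open>h\<close> represents an element of the local ring \<open>O_{X,p}\<close>. Germs are handled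
  through representatives, equality of germs being equality eventually in \<open>nhds p\<close>.
\<close>

definition hol_at :: "('a::t2_space, 'n::finite) atlas \<Rightarrow> 'a \<Rightarrow> ('a \<Rightarrow> complex) \<Rightarrow> bool" where
  "hol_at A p h \<longleftrightarrow> (\<exists>W. p \<in> W \<and> hol_on A W h)"

definition holo_self_map :: "('a::t2_space, 'n::finite) atlas \<Rightarrow> ('a \<Rightarrow> 'a) \<Rightarrow> bool" where
  "holo_self_map A f \<longleftrightarrow> continuous_on UNIV f \<and>
     (\<forall>(U, z)\<in>A. \<forall>(V, w)\<in>A. \<forall>i. holo_fun (\<lambda>v. w (f (inv_into U z v)) $ i) (z ` (U \<inter> f -` V)))"

definition isolated_fixed_point :: "('a::t2_space \<Rightarrow> 'a) \<Rightarrow> 'a \<Rightarrow> bool" where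
  "isolated_fixed_point f p \<longleftrightarrow> f p = p \<and> (\<forall>\<^sub>F q in at p. f q \<noteq> q)"

text \<open>The partial derivative \<open>\<partial>h/\<partial>z_j\<close> in the chart \<open>(U, z)\<close>.\<close>

definition coord_deriv ::
    "'a set \<Rightarrow> ('a \<Rightarrow> complex ^ 'n::finite) \<Rightarrow> 'n \<Rightarrow> ('a \<Rightarrow> complex) \<Rightarrow> 'a \<Rightarrow> complex" where
  "coord_deriv U z j h q = deriv (\<lambda>t. h (inv_into U z (z q + axis j t))) 0"


section \<open>Simple normal crossings divisors and strict logarithmic self-maps\<close>

text \<open>
  A divisor is given by the set \<open>Ds\<close> of its irreducible components; the divisor itself is \<open>\<Union>Ds\<close>. In the
  chart \<open>(U, z)\<close> the components through \<open>p\<close> are, bijectively, the coordinate hyperplanes \<open>z_i = 0\<close> for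
  \<open>i \<in> S\<close>, and the other components do not meet \<open>U\<close>. Thus \<open>z_i\<close> with \<open>i \<in> S\<close> are the normal
  coordinates \<open>z_1, ..., z_k\<close> and those with \<open>i \<notin> S\<close> are the tangential coordinates \<open>w_1, ..., w_m\<close>.
\<close>

definition adapted_chart ::
    "('a::t2_space, 'n::finite) atlas \<Rightarrow> 'a set set \<Rightarrow> 'a \<Rightarrow> 'a set \<Rightarrow> ('a \<Rightarrow> complex ^ 'n) \<Rightarrow> 'n set \<Rightarrow> bool" where
  "adapted_chart A Ds p U z S \<longleftrightarrow> centred_chart A p U z \<and>
     (\<exists>\<sigma>. bij_betw \<sigma> {C \<in> Ds. p \<in> C} S \<and>
          (\<forall>C\<in>Ds. C \<inter> U = (if p \<in> C then {q \<in> U. z q $ \<sigma> C = 0} else {})))"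

text \<open>
  The components are smooth closed hypersurfaces, so irreducibility amounts to connectedness. Local
  finiteness of the family of components is contained in the existence of adapted charts.
\<close>

definition snc_divisor :: "('a::t2_space, 'n::finite) atlas \<Rightarrow> 'a set set \<Rightarrow> bool" where
  "snc_divisor A Ds \<longleftrightarrow>
     (\<forall>C\<in>Ds. C \<noteq> {} \<and> closed C \<and> connected C) \<and> (\<forall>p. \<exists>U z S. adapted_chart A Ds p U z S)"

text \<open>The stalk at \<open>q\<close> of the ideal sheaf of \<open>C\<close>.\<close>

definition ideal_stalk :: "('a::t2_space, 'n::finite) atlas \<Rightarrow> 'a set \<Rightarrow> 'a \<Rightarrow> ('a \<Rightarrow> complex) set" where
  "ideal_stalk A C q = {h. hol_at A q h \<and> (\<forall>\<^sub>F y in nhds q. y \<in> C \<longrightarrow> h y = 0)}"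

text \<open>The stalk at \<open>q\<close> of \<open>f\<inverse> I_C \<cdot> O_X\<close>: the ideal generated by the pull-backs of the germs in \<open>I_{C, f q}\<close>.\<close>

definition pullback_ideal_stalk ::
    "('a::t2_space, 'n::finite) atlas \<Rightarrow> ('a \<Rightarrow> 'a) \<Rightarrow> 'a set \<Rightarrow> 'a \<Rightarrow> ('a \<Rightarrow> complex) set" where
  "pullback_ideal_stalk A f C q = {h. hol_at A q h \<and>
     (\<exists>(m::nat) g u. (\<forall>l<m. g l \<in> ideal_stalk A C (f q) \<and> hol_at A q (u l)) \<and>
        (\<forall>\<^sub>F y in nhds q. h y = (\<Sum>l<m. u l y * g l (f y))))}"

definition strict_log_self_map ::
    "('a::t2_space, 'n::finite) atlas \<Rightarrow> 'a set set \<Rightarrow> ('a \<Rightarrow> 'a) \<Rightarrow> bool" where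
  "strict_log_self_map A Ds f \<longleftrightarrow> holo_self_map A f \<and>
     (\<forall>C\<in>Ds. \<forall>q. pullback_ideal_stalk A f C q = ideal_stalk A C q)"

definition normally_nonresonant ::
    "('a::t2_space, 'n::finite) atlas \<Rightarrow> ('a \<Rightarrow> 'a) \<Rightarrow> 'a \<Rightarrow> ('a \<Rightarrow> complex ^ 'n) \<Rightarrow> 'n set \<Rightarrow> bool" where
  "normally_nonresonant A f p z S \<longleftrightarrow>
     (\<exists>a. (\<forall>i\<in>S. hol_at A p (a i) \<and> a i p \<noteq> 0 \<and> (\<forall>\<^sub>F q in nhds p. z (f q) $ i = z q $ i * a i q)) \<and>
          (\<Prod>i\<in>S. 1 - a i p) \<noteq> 0)"


section \<open>Linearised holomorphic vector bundles\<close>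

text \<open>
  A rank \<open>r\<close> bundle is a projection \<open>pr\<close> from a total space type together with a set \<open>T\<close> of local
  trivialisations \<open>(W, \<psi>)\<close>, where \<open>\<psi> e i\<close> (for \<open>i < r\<close>) are the fibre coordinates of \<open>e\<close>, with
  holomorphic linear transitions. The linear structure of the fibres and the topology of the total space are
  those induced by the trivialisations. A trivialisation is the same thing as a local frame.
\<close>

type_synonym ('a, 'e) trivs = "('a set \<times> ('e \<Rightarrow> nat \<Rightarrow> complex)) set"

definition linear_transition ::
    "('a::t2_space, 'n::finite) atlas \<Rightarrow> nat \<Rightarrow> ('e \<Rightarrow> 'a) \<Rightarrow>
     'a set \<Rightarrow> ('e \<Rightarrow> nat \<Rightarrow> complex) \<Rightarrow> 'a set \<Rightarrow> ('e \<Rightarrow> nat \<Rightarrow> complex) \<Rightarrow> bool" where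
  "linear_transition A r pr W \<psi> V \<theta> \<longleftrightarrow>
     (\<exists>G. (\<forall>i<r. \<forall>j<r. hol_on A (W \<inter> V) (G i j)) \<and>
          (\<forall>e. pr e \<in> W \<inter> V \<longrightarrow> (\<forall>i<r. \<theta> e i = (\<Sum>j<r. G i j (pr e) * \<psi> e j))))"

definition local_frame ::
    "('a::t2_space, 'n::finite) atlas \<Rightarrow> nat \<Rightarrow> ('e \<Rightarrow> 'a) \<Rightarrow> ('a, 'e) trivs \<Rightarrow>
     'a set \<Rightarrow> ('e \<Rightarrow> nat \<Rightarrow> complex) \<Rightarrow> bool" where
  "local_frame A r pr T W \<psi> \<longleftrightarrow> open W \<and>
     (\<forall>x\<in>W. bij_betw \<psi> (pr -` {x}) ({..<r} \<rightarrow>\<^sub>E UNIV)) \<and>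
     (\<forall>(V, \<theta>)\<in>T. linear_transition A r pr W \<psi> V \<theta> \<and> linear_transition A r pr V \<theta> W \<psi>)"

definition holo_vector_bundle ::
    "('a::t2_space, 'n::finite) atlas \<Rightarrow> nat \<Rightarrow> ('e \<Rightarrow> 'a) \<Rightarrow> ('a, 'e) trivs \<Rightarrow> bool" where
  "holo_vector_bundle A r pr T \<longleftrightarrow>
     (\<Union>(W, \<psi>)\<in>T. W) = UNIV \<and> (\<forall>(W, \<psi>)\<in>T. local_frame A r pr T W \<psi>)"

text \<open>
  A bundle morphism \<open>f\<^sup>* E \<rightarrow> E\<close> is a family of linear maps \<open>\<Phi> x : E_{f x} \<rightarrow> E_x\<close> with holomorphic matrices
  in local trivialisations; \<open>\<Phi> x e\<close> is irrelevant unless \<open>pr e = f x\<close>.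
\<close>

definition linearisation ::
    "('a::t2_space, 'n::finite) atlas \<Rightarrow> nat \<Rightarrow> ('e \<Rightarrow> 'a) \<Rightarrow> ('a, 'e) trivs \<Rightarrow>
     ('a \<Rightarrow> 'a) \<Rightarrow> ('a \<Rightarrow> 'e \<Rightarrow> 'e) \<Rightarrow> bool" where
  "linearisation A r pr T f \<Phi> \<longleftrightarrow>
     (\<forall>x e. pr e = f x \<longrightarrow> pr (\<Phi> x e) = x) \<and>
     (\<forall>(U, \<psi>)\<in>T. \<forall>(V, \<theta>)\<in>T. \<exists>M.
        (\<forall>i<r. \<forall>j<r. hol_on A (V \<inter> f -` U) (M i j)) \<and>
        (\<forall>x \<in> V \<inter> f -` U. \<forall>e. pr e = f x \<longrightarrow> (\<forall>i<r. \<theta> (\<Phi> x e) i = (\<Sum>j<r. M i j x * \<psi> e j))))"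

text \<open>The \<open>j\<close>-th section of the local frame belonging to \<open>\<psi>\<close>.\<close>

definition frame_section :: "nat \<Rightarrow> ('e \<Rightarrow> 'a) \<Rightarrow> ('e \<Rightarrow> nat \<Rightarrow> complex) \<Rightarrow> nat \<Rightarrow> 'a \<Rightarrow> 'e" where
  "frame_section r pr \<psi> j x = inv_into (pr -` {x}) \<psi> (\<lambda>i\<in>{..<r}. if i = j then 1 else 0)"

text \<open>
  Trace of the matrix of \<open>\<Phi>\<close>, whose \<open>(i, j)\<close> entry at \<open>x\<close> is the \<open>i\<close>-th coordinate of \<open>\<Phi>_x (e_j (f x))\<close>;
  its class modulo the fixed-point ideal is \<open>\<tau>\<close>.
\<close>

definition frame_trace ::
    "nat \<Rightarrow> ('e \<Rightarrow> 'a) \<Rightarrow> ('e \<Rightarrow> nat \<Rightarrow> complex) \<Rightarrow> ('a \<Rightarrow> 'a) \<Rightarrow> ('a \<Rightarrow> 'e \<Rightarrow> 'e) \<Rightarrow> 'a \<Rightarrow> complex" where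
  "frame_trace r pr \<psi> f \<Phi> x = (\<Sum>i<r. \<psi> (\<Phi> x (frame_section r pr \<psi> i (f x))) i)"


section \<open>The fixed-point algebra and the Grothendieck residue\<close>

definition fixed_ideal ::
    "('a::t2_space, 'n::finite) atlas \<Rightarrow> ('a \<Rightarrow> 'a) \<Rightarrow> 'a \<Rightarrow> ('a \<Rightarrow> complex ^ 'n) \<Rightarrow> ('a \<Rightarrow> complex) set" where
  "fixed_ideal A f p x = {h. hol_at A p h \<and>
     (\<exists>u. (\<forall>j. hol_at A p (u j)) \<and>
          (\<forall>\<^sub>F q in nhds p. h q = (\<Sum>j\<in>UNIV. u j q * (x q $ j - x (f q) $ j))))}"

text \<open>The class of \<open>h\<close> in \<open>A_{f,p} = O_{X,p}/(x_1 - f_1, ..., x_n - f_n)\<close>, as a coset.\<close>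

definition fixed_class ::
    "('a::t2_space, 'n::finite) atlas \<Rightarrow> ('a \<Rightarrow> 'a) \<Rightarrow> 'a \<Rightarrow> ('a \<Rightarrow> complex ^ 'n) \<Rightarrow>
     ('a \<Rightarrow> complex) \<Rightarrow> ('a \<Rightarrow> complex) set" where
  "fixed_class A f p x h = {h'. hol_at A p h' \<and> (\<lambda>q. h' q - h q) \<in> fixed_ideal A f p x}"

text \<open>
  The coefficient of \<open>\<Prod>i. x_i ^ N\<close> in the Taylor expansion of \<open>h\<close> at \<open>p\<close> in the centred coordinates \<open>x\<close>,
  as a mixed partial derivative divided by factorials. The list only fixes an order of differentiation,
  which does not matter for holomorphic \<open>h\<close>.
\<close>

definition taylor_coeff ::
    "'a set \<Rightarrow> ('a \<Rightarrow> complex ^ 'n::finite) \<Rightarrow> 'a \<Rightarrow> nat \<Rightarrow> ('a \<Rightarrow> complex) \<Rightarrow> complex" where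
  "taylor_coeff U x p N h =
     (let l = (SOME l :: 'n list. distinct l \<and> set l = UNIV)
      in foldr (\<lambda>j. coord_deriv U x j ^^ N) l h p / fact N ^ CARD('n))"

text \<open>
  The residue of \<open>h dx_1 \<and> ... \<and> dx_n / (g_1, ..., g_n)\<close> at \<open>p\<close>, defined algebraically: if
  \<open>x_i ^ (N+1) = \<Sum>j. c_ij g_j\<close> in \<open>O_{X,p}\<close>, then as a generalised fraction
  \<open>[h dx / g_1, ..., g_n] = [h det c dx / x_1 ^ (N+1), ..., x_n ^ (N+1)]\<close> (transformation law), and the
  residue of the latter is the coefficient of \<open>(x_1 ... x_n) ^ N\<close> in \<open>h det c\<close>. The value does not depend on
  \<open>(N, c)\<close>. Such \<open>(N, c)\<close> exist whenever \<open>p\<close> is an isolated zero of \<open>g\<close>, by the Nullstellensatz, so the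
  value \<open>0\<close> in the remaining case is a mere totalisation.
\<close>

definition monomial_presentation ::
    "('a::t2_space, 'n::finite) atlas \<Rightarrow> ('a \<Rightarrow> complex ^ 'n) \<Rightarrow> 'a \<Rightarrow> ('a \<Rightarrow> complex ^ 'n) \<Rightarrow>
     nat \<Rightarrow> ('a \<Rightarrow> complex ^ 'n ^ 'n) \<Rightarrow> bool" where
  "monomial_presentation A x p g N c \<longleftrightarrow>
     (\<forall>i j. hol_at A p (\<lambda>q. c q $ i $ j)) \<and>
     (\<forall>\<^sub>F q in nhds p. \<forall>i. x q $ i ^ Suc N = (\<Sum>j\<in>UNIV. c q $ i $ j * g q $ j))"

definition grothendieck_residue ::
    "('a::t2_space, 'n::finite) atlas \<Rightarrow> 'a set \<Rightarrow> ('a \<Rightarrow> complex ^ 'n) \<Rightarrow> 'a \<Rightarrow>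
     ('a \<Rightarrow> complex ^ 'n) \<Rightarrow> ('a \<Rightarrow> complex) \<Rightarrow> complex" where
  "grothendieck_residue A U x p g h =
     (if \<exists>N c. monomial_presentation A x p g N c
      then (case (SOME (N, c). monomial_presentation A x p g N c) of
              (N, c) \<Rightarrow> taylor_coeff U x p N (\<lambda>q. h q * det (c q)))
      else 0)"

text \<open>
  The functional \<open>\<lambda>_{f,p}\<close> on \<open>A_{f,p}\<close>, evaluated on cosets; \<open>THE\<close> expresses that the residue is the same
  for all representatives.
\<close>

definition residue_functional ::
    "('a::t2_space, 'n::finite) atlas \<Rightarrow> ('a \<Rightarrow> 'a) \<Rightarrow> 'a \<Rightarrow> 'a set \<Rightarrow> ('a \<Rightarrow> complex ^ 'n) \<Rightarrow>
     ('a \<Rightarrow> complex) set \<Rightarrow> complex" where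
  "residue_functional A f p U x K =
     (THE s. \<exists>h\<in>K. s = grothendieck_residue A U x p (\<lambda>q. x q - x (f q)) h)"


section \<open>Logarithmic forms and the boundary index\<close>

text \<open>
  A 1-form on the domain of a chart \<open>(U, z)\<close> is given by its coefficient vector with respect to
  \<open>dz_1, ..., dz_n\<close>. The pull-back of \<open>\<Sum>j. b_j dz_j\<close> is \<open>\<Sum>j. (b_j \<circ> f) d(z_j \<circ> f)\<close>.
\<close>

definition form_pullback ::
    "'a set \<Rightarrow> ('a \<Rightarrow> complex ^ 'n::finite) \<Rightarrow> ('a \<Rightarrow> 'a) \<Rightarrow> ('a \<Rightarrow> complex ^ 'n) \<Rightarrow> 'a \<Rightarrow> complex ^ 'n" where
  "form_pullback U z f \<omega> q =
     (\<chi> l. \<Sum>j\<in>UNIV. \<omega> (f q) $ j * coord_deriv U z l (\<lambda>y. z (f y) $ j) q)"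

text \<open>The frame \<open>dz_i/z_i\<close> (\<open>i \<in> S\<close>), \<open>dz_i\<close> (\<open>i \<notin> S\<close>) of the logarithmic 1-forms.\<close>

definition log_frame ::
    "('a \<Rightarrow> complex ^ 'n::finite) \<Rightarrow> 'n set \<Rightarrow> 'n \<Rightarrow> 'a \<Rightarrow> complex ^ 'n" where
  "log_frame z S i q = axis i (if i \<in> S then 1 / z q $ i else 1)"

text \<open>
  \<open>f\<^sup>* \<omega>_i = \<Sum>j. J_ij \<omega>_j\<close> for the logarithmic frame \<open>\<omega>\<close>, with entries of \<open>J\<close> in \<open>O_{X,p}\<close>. The identity is
  imposed off the divisor, where the logarithmic forms are ordinary forms; by density it determines the
  germ of \<open>J\<close> at \<open>p\<close>.
\<close>

definition is_log_jacobian ::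
    "('a::t2_space, 'n::finite) atlas \<Rightarrow> ('a \<Rightarrow> 'a) \<Rightarrow> 'a \<Rightarrow> 'a set \<Rightarrow> ('a \<Rightarrow> complex ^ 'n) \<Rightarrow> 'n set \<Rightarrow>
     ('a \<Rightarrow> complex ^ 'n ^ 'n) \<Rightarrow> bool" where
  "is_log_jacobian A f p V z S J \<longleftrightarrow>
     (\<forall>i j. hol_at A p (\<lambda>q. J q $ i $ j)) \<and>
     (\<forall>\<^sub>F q in nhds p. (\<forall>j\<in>S. z q $ j \<noteq> 0) \<longrightarrow>
        (\<forall>i. form_pullback V z f (log_frame z S i) q = (\<Sum>j\<in>UNIV. J q $ i $ j *s log_frame z S j q)))"

definition log_jacobian ::
    "('a::t2_space, 'n::finite) atlas \<Rightarrow> ('a \<Rightarrow> 'a) \<Rightarrow> 'a \<Rightarrow> 'a set \<Rightarrow> ('a \<Rightarrow> complex ^ 'n) \<Rightarrow> 'n set \<Rightarrow>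
     'a \<Rightarrow> complex ^ 'n ^ 'n" where
  "log_jacobian A f p V z S = (SOME J. is_log_jacobian A f p V z S J)"

text \<open>The polynomial \<open>det (1 + y M)\<close> in \<open>y\<close>.\<close>

definition det_one_plus :: "complex ^ 'n ^ 'n \<Rightarrow> complex poly" where
  "det_one_plus M = det (mat 1 + (\<chi> i j. monom (M $ i $ j) 1) :: complex poly ^ 'n ^ 'n)"

text \<open>
  The index \<open>\<lambda>_{f,p} (\<tau> det (1 + y J))\<close> as a polynomial in \<open>y\<close>, with \<open>\<lambda>_{f,p}\<close> applied coefficientwise. It is
  computed in centred coordinates \<open>(U, x)\<close> for the residue, adapted coordinates \<open>(V, z)\<close> with normal
  directions \<open>S\<close> for the logarithmic forms, and the local frame of \<open>E\<close> belonging to \<open>\<psi>\<close>.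
\<close>

definition boundary_index ::
    "('a::t2_space, 'n::finite) atlas \<Rightarrow> nat \<Rightarrow> ('e \<Rightarrow> 'a) \<Rightarrow> ('a \<Rightarrow> 'a) \<Rightarrow> ('a \<Rightarrow> 'e \<Rightarrow> 'e) \<Rightarrow> 'a \<Rightarrow>
     'a set \<Rightarrow> ('a \<Rightarrow> complex ^ 'n) \<Rightarrow> 'a set \<Rightarrow> ('a \<Rightarrow> complex ^ 'n) \<Rightarrow> 'n set \<Rightarrow>
     ('e \<Rightarrow> nat \<Rightarrow> complex) \<Rightarrow> complex poly" where
  "boundary_index A r pr f \<Phi> p U x V z S \<psi> =
     (\<Sum>d\<le>CARD('n). monom
        (residue_functional A f p U x
          (fixed_class A f p x
            (\<lambda>q. frame_trace r pr \<psi> f \<Phi> q * coeff (det_one_plus (log_jacobian A f p V z S q)) d))) d)"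

end

theory Submission
  imports Defs "HOL-Complex_Analysis.Cauchy_Integral_Formula"
begin

text \<open>
  For \<open>i \<in> S\<close> the function \<open>z_i - f\<^sup>* z_i = z_i (1 - a_i)\<close> lies in the fixed-point ideal (which does not depend
  on the coordinates, by Hadamard's lemma), and \<open>1 - a_i\<close> is a unit by non-resonance; hence \<open>z_i\<close> itself lies in the
  ideal. The logarithmic Jacobian differs from the identity in the columns \<open>j \<in> S\<close> by multiples of \<open>z_j\<close>, so
  modulo the ideal these columns of \<open>1 + y J\<close> are \<open>(1 + y) e_j\<close> and \<open>(1 + y)^k\<close> factors out of the determinant.
  The residue functional is linear and vanishes on the ideal: writing \<open>x_i ^ (N+1) = \<Sum>j. c_ij g_j\<close> with
  \<open>g_j = x_j - f\<^sup>* x_j\<close>,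
  Cramer's rule puts \<open>g_j det c\<close> into the ideal generated by the \<open>x_i ^ (N+1)\<close>, none of whose elements has
  a monomial \<open>(x_1 ... x_n) ^ N\<close>.
\<close>


section \<open>Holomorphic functions of several variables\<close>

text \<open>Chart functions are only known to have a complex linear Frechet derivative at each
  point. Taylor coefficients and Hadamard's lemma need partial derivatives that are again
  holomorphic, so the theory of several variables is built from Cauchy's formula on coordinate
  lines. The index mixes three independent choices of local data: \<open>x\<close> for the residue,
  \<open>z\<close> for the logarithmic forms, a local frame for the trace. Everything is therefore
  compared inside one ideal, the one generated by the differences x_j - x_j o f. Both
  \<open>log_jacobian\<close> and the presentation (N, c) behind the residue are values of
  \<open>SOME\<close>. Two logarithmic Jacobians agree off the divisor, hence as germs, so what is
  computed for an explicit one holds for the chosen one. The pair (N, c) depends on the denominators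
  only, so a single pair serves all numerators \<open>h\<close>. The value at -1 follows from
  divisibility because a point of the divisor lies on at least one branch.\<close>

definition cdiff :: "(complex ^ 'n \<Rightarrow> complex) \<Rightarrow> complex ^ 'n \<Rightarrow> bool" where
  "cdiff F v \<longleftrightarrow> (\<exists>g :: complex ^ 'n. (F has_derivative (\<lambda>w. \<Sum>i\<in>UNIV. g $ i * w $ i)) (at v))"

text \<open>Total because \<open>deriv\<close> is; it is \<open>coord_deriv\<close> read in a chart,
  which is why it is defined through the coordinate line and not through the Frechet
  derivative.\<close>

definition pd :: "'n \<Rightarrow> (complex ^ 'n::finite \<Rightarrow> complex) \<Rightarrow> complex ^ 'n \<Rightarrow> complex" where
  "pd j F v = deriv (\<lambda>t. F (v + axis j t)) 0"

section \<open>Complex differentiability and coordinate lines\<close>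

lemma norm_axis: "norm (axis j x :: 'b::real_normed_vector ^ 'n::finite) = norm x"
proof -
  have "(\<Sum>i\<in>UNIV. (norm ((axis j x :: 'b ^ 'n) $ i))\<^sup>2) = (\<Sum>i\<in>UNIV. if i = j then (norm x)\<^sup>2 else 0)"
    by (intro sum.cong) (auto simp: axis_def)
  then show ?thesis
    by (simp add: norm_vec_def L2_set_def)
qed

lemma axis_zero [simp]: "axis j 0 = 0"
  by (simp add: vec_eq_iff axis_def)

lemma bounded_linear_axis: "bounded_linear (axis j :: 'b::real_normed_vector \<Rightarrow> 'b ^ 'n::finite)"
proof
  show "\<exists>K. \<forall>x::'b. norm (axis j x :: 'b ^ 'n) \<le> norm x * K"
    by (rule exI[of _ 1]) (simp add: norm_axis)
qed (auto simp: vec_eq_iff axis_def)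

text \<open>The entrance to one-variable theory: a complex linear derivative restricted to a
  coordinate line is multiplication by one entry of the gradient.\<close>

lemma has_derivative_along_axis:
  fixes F :: "complex ^ 'n::finite \<Rightarrow> complex"
  assumes "(F has_derivative (\<lambda>w. \<Sum>i\<in>UNIV. g $ i * w $ i)) (at (v + axis j t))"
  shows "((\<lambda>t. F (v + axis j t)) has_field_derivative g $ j) (at t)"
proof -
  have "((\<lambda>t. v + axis j t) has_derivative axis j) (at t)"
    by (auto intro!: derivative_eq_intros bounded_linear_imp_has_derivative bounded_linear_axis)
  from has_derivative_compose[OF this assms]
  have "((\<lambda>t. F (v + axis j t)) has_derivative (\<lambda>h. \<Sum>i\<in>UNIV. g $ i * axis j h $ i)) (at t)" .
  moreover have "(\<lambda>h. \<Sum>i\<in>UNIV. g $ i * axis j h $ i) = (*) (g $ j)"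
    by (auto simp: axis_def if_distrib[of "\<lambda>u. _ * u"] cong: if_cong)
  ultimately show ?thesis
    by (simp add: has_field_derivative_def)
qed

text \<open>The gradient whose existence \<open>cdiff\<close> asserts is unique, since its entries
  are the derivatives along the axes; from here on \<open>pd\<close> replaces the existential
  witness.\<close>

lemma cdiff_has_derivative:
  assumes "cdiff F v"
  shows "(F has_derivative (\<lambda>w. \<Sum>i\<in>UNIV. pd i F v * w $ i)) (at v)"
proof -
  obtain g where g: "(F has_derivative (\<lambda>w. \<Sum>i\<in>UNIV. g $ i * w $ i)) (at v)"
    using assms by (auto simp: cdiff_def)
  have "pd i F v = g $ i" for i
    unfolding pd_def using has_derivative_along_axis[of F g v i 0] g
    by (intro DERIV_imp_deriv) simp
  with g show ?thesis by simp
qed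

lemma cdiff_pdI:
  assumes "(F has_derivative (\<lambda>w. \<Sum>i\<in>UNIV. g i * w $ i)) (at v)"
  shows "cdiff F v" and "pd j F v = g j"
proof -
  have *: "(F has_derivative (\<lambda>w. \<Sum>i\<in>UNIV. (\<chi> i. g i) $ i * w $ i)) (at v)"
    using assms by simp
  then show "cdiff F v" unfolding cdiff_def by blast
  show "pd j F v = g j"
    unfolding pd_def using has_derivative_along_axis[of F "\<chi> i. g i" v j 0] *
    by (intro DERIV_imp_deriv) simp
qed

lemma cdiff_along_axis:
  assumes "cdiff F (v + axis j t)"
  shows "((\<lambda>t. F (v + axis j t)) has_field_derivative pd j F (v + axis j t)) (at t)"
  using has_derivative_along_axis[of F "\<chi> i. pd i F (v + axis j t)" v j t]
    cdiff_has_derivative[OF assms] by simp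

lemma cdiff_imp_isCont: "cdiff F v \<Longrightarrow> isCont F v"
  unfolding cdiff_def using has_derivative_continuous by blast

lemma cdiff_cong:
  assumes "cdiff F v" "\<forall>\<^sub>F u in nhds v. F u = G u"
  shows "cdiff G v"
proof -
  have ev: "\<forall>\<^sub>F u in at v. F u = G u"
    using assms(2) by (auto simp: eventually_at_filter elim: eventually_mono)
  have "F v = G v"
    using assms(2) by (rule eventually_nhds_x_imp_x)
  obtain g where "(F has_derivative (\<lambda>w. \<Sum>i\<in>UNIV. g $ i * w $ i)) (at v)"
    using assms(1) by (auto simp: cdiff_def)
  then have "(G has_derivative (\<lambda>w. \<Sum>i\<in>UNIV. g $ i * w $ i)) (at v)"
    by (rule has_derivative_transform_eventually[OF _ ev \<open>F v = G v\<close>]) simp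
  then show ?thesis
    unfolding cdiff_def by blast
qed

lemma pd_cong:
  assumes "\<forall>\<^sub>F u in nhds v. F u = G u"
  shows "pd j F v = pd j G v"
proof -
  have "isCont (\<lambda>t. v + axis j t) 0"
    by (intro continuous_intros linear_continuous_at bounded_linear_axis)
  then have "filterlim (\<lambda>t. v + axis j t) (nhds v) (nhds 0)"
    using tendsto_at_iff_tendsto_nhds[of "\<lambda>t. v + axis j t" 0] by (simp add: isCont_def)
  from eventually_compose_filterlim[OF assms this] show ?thesis
    unfolding pd_def by (intro deriv_cong_ev) auto
qed

section \<open>Cauchy's formula and holomorphy of partial derivatives\<close>

text \<open>Cauchy's formula for the first derivative on the coordinate line through
  \<open>v\<close>. The derivative of the circle path cancels the factor 2 pi i and one of the two
  powers in the denominator. The fixed interval {0..1} leaves \<open>v\<close> only inside the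
  integrand, ready for differentiation under the integral sign.\<close>

lemma pd_circle_integral:
  assumes diff: "\<And>u. u \<in> V \<Longrightarrow> cdiff F u" and r: "r > 0" and V: "cball v r \<subseteq> V"
  shows "pd j F v = integral {0..1} (\<lambda>t. F (v + axis j (of_real r * exp (2 * of_real pi * \<i> * of_real t)))
           / (of_real r * exp (2 * of_real pi * \<i> * of_real t)))"
proof -
  let ?f = "\<lambda>t. F (v + axis j t)"
  have der: "(?f has_field_derivative pd j F (v + axis j t)) (at t)" if "t \<in> cball 0 r" for t
  proof -
    have "v + axis j t \<in> cball v r"
      using that by (simp add: dist_norm norm_axis)
    with V show ?thesis by (intro cdiff_along_axis diff) auto
  qed
  have "continuous_on (cball 0 r) ?f"
    using der by (intro continuous_at_imp_continuous_on ballI DERIV_isCont) blast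
  moreover have "?f holomorphic_on ball 0 r"
    unfolding holomorphic_on_def field_differentiable_def
    using der has_field_derivative_at_within by (meson ball_subset_cball subsetD)
  ultimately have "(?f has_field_derivative 1 / (2 * of_real pi * \<i>) *
      contour_integral (circlepath 0 r) (\<lambda>u. ?f u / (u - 0)\<^sup>2)) (at 0)"
    using r by (intro Cauchy_derivative_integral_circlepath) auto
  then have "pd j F v = 1 / (2 * of_real pi * \<i>) *
      contour_integral (circlepath 0 r) (\<lambda>u. ?f u / u\<^sup>2)"
    by (simp add: pd_def DERIV_imp_deriv)
  also have "contour_integral (circlepath 0 r) (\<lambda>u. ?f u / u\<^sup>2) =
     integral {0..1} (\<lambda>t. (2 * of_real pi * \<i>) * (?f (of_real r * exp (2 * of_real pi * \<i> * of_real t))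
        / (of_real r * exp (2 * of_real pi * \<i> * of_real t))))"
    unfolding contour_integral_integral
  proof (intro integral_cong)
    fix t :: real
    have "vector_derivative (circlepath 0 r) (at t) =
        2 * of_real pi * \<i> * (of_real r * exp (2 * of_real pi * \<i> * of_real t))"
      by (simp add: vector_derivative_circlepath)
    moreover have "circlepath 0 r t = of_real r * exp (2 * of_real pi * \<i> * of_real t)"
      by (simp add: circlepath)
    ultimately show "?f (circlepath 0 r t) / (circlepath 0 r t)\<^sup>2 * vector_derivative (circlepath 0 r) (at t) =
      2 * of_real pi * \<i> * (?f (of_real r * exp (2 * of_real pi * \<i> * of_real t))
        / (of_real r * exp (2 * of_real pi * \<i> * of_real t)))"
      using r by (simp add: power2_eq_square)
  qed
  finally show ?thesis unfolding integral_mult_right by simp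
qed

lemma continuous_on_slice:
  assumes "continuous_on (B \<times> T) (\<lambda>(v, t). g v t)" "v \<in> B"
  shows "continuous_on T (g v)"
  using continuous_on_compose2[OF assms(1), of T "\<lambda>t. (v, t)"] assms(2)
  by (auto simp: continuous_on_Pair continuous_on_const continuous_on_id)

text \<open>Differentiation under the integral sign. Complex linearity survives because the gradient
  of the integral is the integral of the gradients.\<close>

lemma cdiff_integral:
  fixes H :: "complex ^ 'n::finite \<Rightarrow> real \<Rightarrow> complex" and g :: "'n \<Rightarrow> complex ^ 'n \<Rightarrow> real \<Rightarrow> complex"
  assumes der: "\<And>v t. v \<in> B \<Longrightarrow> t \<in> {0..1} \<Longrightarrow> ((\<lambda>v. H v t) has_derivative (\<lambda>w. \<Sum>i\<in>UNIV. g i v t * w $ i)) (at v)"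
    and cont: "\<And>v. v \<in> B \<Longrightarrow> continuous_on {0..1} (H v)"
    and contg: "\<And>i. continuous_on (B \<times> {0..1}) (\<lambda>(v, t). g i v t)"
    and B: "open B" "convex B" and v: "v \<in> B"
  shows "cdiff (\<lambda>v. integral {0..1} (H v)) v"
proof -
  \<comment> \<open>\<open>leibniz_rule\<close> expects the derivative as a continuous family of
    bounded linear operators, so the gradients \<open>g\<close> are packaged as such.\<close>
  define bl where "bl v t = (\<Sum>i\<in>UNIV. blinfun_mult_right (g i v t) o\<^sub>L Blinfun (\<lambda>w :: complex ^ 'n. w $ i))" for v t
  have bl_apply: "blinfun_apply (bl v t) w = (\<Sum>i\<in>UNIV. g i v t * w $ i)" for v t w
    by (simp add: bl_def blinfun.sum_left bounded_linear_Blinfun_apply bounded_linear_vec_nth)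
  have contbl: "continuous_on (B \<times> {0..1}) (\<lambda>(v, t). bl v t)"
    unfolding bl_def split_def
    by (intro continuous_intros bounded_linear.continuous_on[OF bounded_linear_blinfun_mult_right]
        contg[unfolded split_def])
  have "((\<lambda>v. integral (cbox 0 1) (H v)) has_derivative blinfun_apply (integral (cbox 0 1) (bl v))) (at v within B)"
  proof (rule leibniz_rule)
    show "((\<lambda>v. H v t) has_derivative blinfun_apply (bl v t)) (at v within B)"
      if "v \<in> B" "t \<in> cbox 0 1" for v t
    proof -
      have "blinfun_apply (bl v t) = (\<lambda>w. \<Sum>i\<in>UNIV. g i v t * w $ i)"
        by (auto simp: bl_apply)
      with der[of v t] that show ?thesis
        by (auto intro: has_derivative_at_withinI)
    qed
    show "H v integrable_on cbox 0 1" if "v \<in> B" for v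
      using cont[OF that] by (intro integrable_continuous) simp
  qed (use contbl B v in auto)
  then have "((\<lambda>v. integral {0..1} (H v)) has_derivative blinfun_apply (integral {0..1} (bl v))) (at v)"
    unfolding at_within_open[OF v B(1)] by simp
  \<comment> \<open>Evaluation at \<open>w\<close> commutes with the integral; this exhibits the
    integrated operator as a complex gradient.\<close>
  moreover have "blinfun_apply (integral {0..1} (bl v)) w = (\<Sum>i\<in>UNIV. integral {0..1} (g i v) * w $ i)" for w
  proof -
    have c: "continuous_on {0..1} (bl v)" "continuous_on {0..1} (g i v)" for i
      using continuous_on_slice[OF contbl v] continuous_on_slice[OF contg v] by auto
    have "blinfun_apply (integral {0..1} (bl v)) w = integral {0..1} (\<lambda>t. blinfun_apply (bl v t) w)"
      using blinfun_apply_integral[of "bl v" "{0..1}" w] c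
      by (simp add: integrable_continuous_real)
    also have "\<dots> = (\<Sum>i\<in>UNIV. integral {0..1} (\<lambda>t. g i v t * w $ i))"
      unfolding bl_apply
      by (intro integral_sum integrable_continuous_real continuous_intros c) auto
    finally show ?thesis by simp
  qed
  then have "blinfun_apply (integral {0..1} (bl v)) = (\<lambda>w. \<Sum>i\<in>UNIV. integral {0..1} (g i v) * w $ i)"
    by (rule ext)
  ultimately have "((\<lambda>v. integral {0..1} (H v)) has_derivative
      (\<lambda>w. \<Sum>i\<in>UNIV. integral {0..1} (g i v) * w $ i)) (at v)"
    by simp
  then show ?thesis by (rule cdiff_pdI)
qed

text \<open>One radius r serves all centres within r of \<open>v\<close>; hence the room 2 r,
  obtained below by halving the radius of a ball inside \<open>V\<close>.\<close>

lemma circle_in_cball: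
  fixes v :: "complex ^ 'n::finite"
  assumes "u \<in> ball v r" "cball v (2 * r) \<subseteq> V" "r > 0"
  shows "u + axis j (of_real r * exp (2 * of_real pi * \<i> * of_real t)) \<in> V"
proof -
  have "norm (axis j (of_real r * exp (2 * of_real pi * \<i> * of_real t) :: complex) :: complex ^ 'n) = r"
    using assms(3) by (simp add: norm_axis norm_mult)
  then have "dist v (u + axis j (of_real r * exp (2 * of_real pi * \<i> * of_real t))) \<le> 2 * r"
    using assms(1) dist_triangle[of v "u + axis j (of_real r * exp (2 * of_real pi * \<i> * of_real t))" u]
    by (simp add: dist_norm)
  with assms(2) show ?thesis by auto
qed

lemma circle_param_continuous:
  assumes cont: "continuous_on V G" and r: "r > 0" and V: "cball v (2 * r) \<subseteq> V"
  shows "continuous_on (ball v r \<times> {0..1})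
    (\<lambda>(u, t). G (u + axis j (of_real r * exp (2 * of_real pi * \<i> * of_real t)))
       / (of_real r * exp (2 * of_real pi * \<i> * of_real t)) :: complex)"
  unfolding split_def
  by (intro continuous_intros continuous_on_compose2[OF cont]
      bounded_linear.continuous_on[OF bounded_linear_axis])
    (use r circle_in_cball[OF _ V r] in auto)

text \<open>Pointwise differentiability alone says nothing about continuity of the derivative; it
  comes from the Cauchy integral, whose integrand is jointly continuous in centre and
  parameter.\<close>

lemma continuous_on_pd:
  assumes V: "open V" and diff: "\<And>u. u \<in> V \<Longrightarrow> cdiff F u"
  shows "continuous_on V (pd j F)"
proof -
  have contF: "continuous_on V F"
    by (intro continuous_at_imp_continuous_on ballI cdiff_imp_isCont diff)
  have "isCont (pd j F) v" if v: "v \<in> V" for v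
  proof -
    obtain e where e: "e > 0" "cball v e \<subseteq> V"
      using V v open_contains_cball by blast
    define r where "r = e / 2"
    have r: "r > 0" "cball v (2 * r) \<subseteq> V" using e by (auto simp: r_def)
    have "continuous_on (ball v r) (\<lambda>u. integral (cbox 0 1)
        (\<lambda>t. F (u + axis j (of_real r * exp (2 * of_real pi * \<i> * of_real t)))
           / (of_real r * exp (2 * of_real pi * \<i> * of_real t))))"
      using circle_param_continuous[OF contF r] by (intro integral_continuous_on_param) simp
    moreover have "integral (cbox 0 1)
        (\<lambda>t. F (u + axis j (of_real r * exp (2 * of_real pi * \<i> * of_real t)))
           / (of_real r * exp (2 * of_real pi * \<i> * of_real t))) = pd j F u" if "u \<in> ball v r" for u
    proof -
      have "cball u r \<subseteq> cball v (2 * r)"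
        using that by (simp add: cball_subset_cball_iff dist_commute)
      with r have "cball u r \<subseteq> V" by blast
      then show ?thesis
        using pd_circle_integral[of V F r u j] diff r by simp
    qed
    ultimately have "continuous_on (ball v r) (pd j F)"
      by (rule continuous_on_eq)
    with r show ?thesis
      by (simp add: continuous_on_eq_continuous_at)
  qed
  then show ?thesis by (intro continuous_at_imp_continuous_on) auto
qed

lemma cdiff_translate_has_derivative:
  assumes "cdiff F (v + c)"
  shows "((\<lambda>v. F (v + c)) has_derivative (\<lambda>w. \<Sum>i\<in>UNIV. pd i F (v + c) * w $ i)) (at v)"
proof -
  have "((\<lambda>v. v + c) has_derivative (\<lambda>w. w)) (at v)"
    by (auto intro!: derivative_eq_intros)
  from has_derivative_compose[OF this cdiff_has_derivative[OF assms]] show ?thesis .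
qed

text \<open>The Cauchy integral for \<open>pd j F\<close> is differentiated under the integral sign.
  The gradient of its integrand contains only first derivatives of \<open>F\<close>, whose
  continuity is already known, so nothing about second derivatives is presupposed.\<close>

lemma cdiff_pd:
  assumes V: "open V" and diff: "\<And>u. u \<in> V \<Longrightarrow> cdiff F u" and v: "v \<in> V"
  shows "cdiff (pd j F) v"
proof -
  have contF: "continuous_on V F"
    by (intro continuous_at_imp_continuous_on ballI cdiff_imp_isCont diff)
  obtain e where e: "e > 0" "cball v e \<subseteq> V"
    using V v open_contains_cball by blast
  define r where "r = e / 2"
  have r: "r > 0" "cball v (2 * r) \<subseteq> V" using e by (auto simp: r_def)
  define H where "H u t = F (u + axis j (of_real r * exp (2 * of_real pi * \<i> * of_real t)))
           / (of_real r * exp (2 * of_real pi * \<i> * of_real t))" for u and t :: real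
  define g where "g i u t = pd i F (u + axis j (of_real r * exp (2 * of_real pi * \<i> * of_real t)))
           / (of_real r * exp (2 * of_real pi * \<i> * of_real t))" for i u and t :: real
  have "cdiff (\<lambda>u. integral {0..1} (H u)) v"
  proof (rule cdiff_integral[where B = "ball v r" and g = g])
    show "((\<lambda>u. H u t) has_derivative (\<lambda>w. \<Sum>i\<in>UNIV. g i u t * w $ i)) (at u)"
      if "u \<in> ball v r" "t \<in> {0..1}" for u t
    proof -
      let ?c = "of_real r * exp (2 * of_real pi * \<i> * of_real t) :: complex"
      have "((\<lambda>u. F (u + axis j ?c) / ?c) has_derivative
          (\<lambda>w. (\<Sum>i\<in>UNIV. pd i F (u + axis j ?c) * w $ i) / ?c)) (at u)"
        using bounded_linear.has_derivative[OF bounded_linear_divide[of ?c]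
            cdiff_translate_has_derivative[OF diff[OF circle_in_cball[OF that(1) r(2,1)]]]] .
      moreover have "(\<lambda>w. (\<Sum>i\<in>UNIV. pd i F (u + axis j ?c) * w $ i) / ?c) = (\<lambda>w. \<Sum>i\<in>UNIV. g i u t * w $ i)"
        unfolding g_def sum_divide_distrib by simp
      ultimately show ?thesis
        unfolding H_def by (simp only:)
    qed
    show "continuous_on (ball v r \<times> {0..1}) (\<lambda>(u, t). g i u t)" for i
      unfolding g_def by (intro circle_param_continuous[OF continuous_on_pd[OF V diff]] r)
    show "continuous_on {0..1} (H u)" if "u \<in> ball v r" for u
      using continuous_on_slice[OF circle_param_continuous[OF contF r, of j] that]
      unfolding H_def[abs_def] .
  qed (use r in auto)
  moreover have "integral {0..1} (H u) = pd j F u" if "u \<in> ball v r" for u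
  proof -
    have "cball u r \<subseteq> cball v (2 * r)"
      using that by (simp add: cball_subset_cball_iff dist_commute)
    with r have "cball u r \<subseteq> V" by blast
    then show ?thesis
      using pd_circle_integral[of V F r u j] diff r by (simp add: H_def[abs_def])
  qed
  then have "\<forall>\<^sub>F u in nhds v. integral {0..1} (H u) = pd j F u"
    using r(1) by (intro eventually_nhds_in_open[of "ball v r" v, THEN eventually_mono]) auto
  ultimately show ?thesis by (rule cdiff_cong)
qed

text \<open>Phrased with \<open>nhds\<close> so that hypotheses about germs combine by
  \<open>eventually_elim\<close> and pass to nearby points by
  \<open>eventually_eventually\<close>.\<close>

definition cgerm :: "(complex ^ 'n::finite \<Rightarrow> complex) \<Rightarrow> complex ^ 'n \<Rightarrow> bool" where
  "cgerm F v \<longleftrightarrow> (\<forall>\<^sub>F u in nhds v. cdiff F u)"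

lemma cgermE:
  assumes "cgerm F v"
  obtains V where "open V" "v \<in> V" "\<And>u. u \<in> V \<Longrightarrow> cdiff F u"
  using assms unfolding cgerm_def eventually_nhds by blast

lemma cgerm_imp_cdiff: "cgerm F v \<Longrightarrow> cdiff F v"
  unfolding cgerm_def by (rule eventually_nhds_x_imp_x)

lemma cgerm_cong:
  assumes "cgerm F v" "\<forall>\<^sub>F u in nhds v. F u = G u"
  shows "cgerm G v"
proof -
  have "\<forall>\<^sub>F u in nhds v. \<forall>\<^sub>F w in nhds u. F w = G w"
    using assms(2) by (simp add: eventually_eventually)
  with assms(1) show ?thesis
    unfolding cgerm_def by eventually_elim (rule cdiff_cong)
qed

lemma cgerm_pd: "cgerm F v \<Longrightarrow> cgerm (pd j F) v"
  by (erule cgermE) (auto simp: cgerm_def eventually_nhds intro: cdiff_pd)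

section \<open>Differentiation rules and composition\<close>

lemma cdiff_const: "cdiff (\<lambda>u. c) v" "pd j (\<lambda>u. c) v = 0"
  using cdiff_pdI[of "\<lambda>u. c" "\<lambda>i. 0" v] by (simp_all)

lemma cdiff_nth: "cdiff (\<lambda>u. u $ i) v" "pd j (\<lambda>u. u $ i) v = (if j = i then 1 else 0)"
proof -
  have "((\<lambda>u. u $ i) has_derivative (\<lambda>w. w $ i)) (at v)"
    by (intro bounded_linear_imp_has_derivative bounded_linear_vec_nth)
  moreover have "(\<lambda>w::complex^'a. w $ i) = (\<lambda>w. \<Sum>k\<in>UNIV. (if k = i then 1 else 0) * w $ k)"
    by (simp add: if_distrib[of "\<lambda>u. u * _"] cong: if_cong)
  ultimately have "((\<lambda>u. u $ i) has_derivative (\<lambda>w. \<Sum>k\<in>UNIV. (if k = i then 1 else 0) * w $ k)) (at v)"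
    by simp
  from cdiff_pdI[OF this] show "cdiff (\<lambda>u. u $ i) v" "pd j (\<lambda>u. u $ i) v = (if j = i then 1 else 0)" .
qed

lemma cdiff_add:
  assumes "cdiff F v" "cdiff G v"
  shows "cdiff (\<lambda>u. F u + G u) v" "pd j (\<lambda>u. F u + G u) v = pd j F v + pd j G v"
proof -
  have "((\<lambda>u. F u + G u) has_derivative (\<lambda>w. \<Sum>i\<in>UNIV. (pd i F v + pd i G v) * w $ i)) (at v)"
    using has_derivative_add[OF assms[THEN cdiff_has_derivative]]
    by (simp add: algebra_simps sum.distrib)
  from cdiff_pdI[OF this] show "cdiff (\<lambda>u. F u + G u) v" "pd j (\<lambda>u. F u + G u) v = pd j F v + pd j G v" .
qed

lemma cdiff_mult:
  assumes "cdiff F v" "cdiff G v"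
  shows "cdiff (\<lambda>u. F u * G u) v" "pd j (\<lambda>u. F u * G u) v = pd j F v * G v + F v * pd j G v"
proof -
  have "((\<lambda>u. F u * G u) has_derivative (\<lambda>w. \<Sum>i\<in>UNIV. (pd i F v * G v + F v * pd i G v) * w $ i)) (at v)"
    using has_derivative_mult[OF assms[THEN cdiff_has_derivative]]
    by (simp add: algebra_simps sum.distrib sum_distrib_left)
  from cdiff_pdI[OF this]
  show "cdiff (\<lambda>u. F u * G u) v" "pd j (\<lambda>u. F u * G u) v = pd j F v * G v + F v * pd j G v" .
qed

lemma cdiff_inverse:
  assumes "cdiff F v" "F v \<noteq> 0"
  shows "cdiff (\<lambda>u. inverse (F u)) v"
proof -
  have "((\<lambda>u. inverse (F u)) has_derivative (\<lambda>w. \<Sum>i\<in>UNIV. (- inverse (F v) * pd i F v * inverse (F v)) * w $ i)) (at v)"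
    using Deriv.has_derivative_inverse[OF assms(2) cdiff_has_derivative[OF assms(1)]]
    by (simp add: algebra_simps sum_distrib_left sum_negf)
  then show ?thesis by (rule cdiff_pdI)
qed

lemma has_derivative_vec_lambda:
  fixes \<phi> :: "'n::finite \<Rightarrow> 'b::real_normed_vector \<Rightarrow> 'c::real_normed_vector"
  assumes "\<And>i. (\<phi> i has_derivative d i) (at v)"
  shows "((\<lambda>u. \<chi> i. \<phi> i u) has_derivative (\<lambda>w. \<chi> i. d i w)) (at v)"
proof -
  have eq: "(\<chi> i. a i) = (\<Sum>i\<in>UNIV. axis i (a i))" for a :: "'n \<Rightarrow> 'c"
    by (simp add: vec_eq_iff axis_def if_distrib cong: if_cong)
  show ?thesis
    unfolding eq by (intro has_derivative_sum bounded_linear.has_derivative[OF bounded_linear_axis] assms)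
qed

text \<open>The inner map is given by its components, so scalar-valued \<open>cdiff\<close> suffices
  throughout; transition maps are later expanded as \<open>\<chi> i. ...\<close> to fit this
  shape.\<close>

lemma cdiff_compose:
  assumes F: "cdiff F (\<chi> i. \<phi> i v)" and \<phi>: "\<And>i. cdiff (\<phi> i) v"
  shows "cdiff (\<lambda>u. F (\<chi> i. \<phi> i u)) v"
    and "pd k (\<lambda>u. F (\<chi> i. \<phi> i u)) v = (\<Sum>i\<in>UNIV. pd i F (\<chi> i. \<phi> i v) * pd k (\<phi> i) v)"
proof -
  have "((\<lambda>u. \<chi> i. \<phi> i u) has_derivative (\<lambda>w. \<chi> i. \<Sum>k\<in>UNIV. pd k (\<phi> i) v * w $ k)) (at v)"
    by (intro has_derivative_vec_lambda cdiff_has_derivative \<phi>)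
  from has_derivative_compose[OF this cdiff_has_derivative[OF F]]
  have "((\<lambda>u. F (\<chi> i. \<phi> i u)) has_derivative
      (\<lambda>w. \<Sum>i\<in>UNIV. pd i F (\<chi> i. \<phi> i v) * (\<Sum>k\<in>UNIV. pd k (\<phi> i) v * w $ k))) (at v)"
    by simp
  moreover have "(\<Sum>i\<in>UNIV. pd i F (\<chi> i. \<phi> i v) * (\<Sum>k\<in>UNIV. pd k (\<phi> i) v * w $ k)) =
      (\<Sum>k\<in>UNIV. (\<Sum>i\<in>UNIV. pd i F (\<chi> i. \<phi> i v) * pd k (\<phi> i) v) * w $ k)" for w
    unfolding sum_distrib_left sum_distrib_right by (subst sum.swap) (simp add: mult.assoc)
  ultimately have "((\<lambda>u. F (\<chi> i. \<phi> i u)) has_derivative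
      (\<lambda>w. \<Sum>k\<in>UNIV. (\<Sum>i\<in>UNIV. pd i F (\<chi> i. \<phi> i v) * pd k (\<phi> i) v) * w $ k)) (at v)"
    by simp
  from cdiff_pdI[OF this]
  show "cdiff (\<lambda>u. F (\<chi> i. \<phi> i u)) v"
    and "pd k (\<lambda>u. F (\<chi> i. \<phi> i u)) v = (\<Sum>i\<in>UNIV. pd i F (\<chi> i. \<phi> i v) * pd k (\<phi> i) v)" .
qed

lemma isCont_vec_lambda:
  fixes \<phi> :: "'n::finite \<Rightarrow> 'b::t2_space \<Rightarrow> 'c::topological_space"
  assumes "\<And>i. isCont (\<phi> i) v"
  shows "isCont (\<lambda>u. \<chi> i. \<phi> i u) v"
  using assms unfolding isCont_def by (intro tendsto_vec_lambda)

lemma cgerm_compose: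
  assumes F: "cgerm F (\<chi> i. \<phi> i v)" and \<phi>: "\<And>i. cgerm (\<phi> i) v"
  shows "cgerm (\<lambda>u. F (\<chi> i. \<phi> i u)) v"
proof -
  have "isCont (\<lambda>u. \<chi> i. \<phi> i u) v"
    by (intro isCont_vec_lambda cdiff_imp_isCont cgerm_imp_cdiff \<phi>)
  then have "filterlim (\<lambda>u. \<chi> i. \<phi> i u) (nhds (\<chi> i. \<phi> i v)) (nhds v)"
    using tendsto_at_iff_tendsto_nhds[of "\<lambda>u. \<chi> i. \<phi> i u" v] by (simp add: isCont_def)
  from eventually_compose_filterlim[OF F[unfolded cgerm_def] this]
  have "\<forall>\<^sub>F u in nhds v. cdiff F (\<chi> i. \<phi> i u)" .
  moreover have "\<forall>\<^sub>F u in nhds v. \<forall>i. cdiff (\<phi> i) u"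
    using \<phi> unfolding cgerm_def by (simp add: eventually_all_finite)
  ultimately show ?thesis
    unfolding cgerm_def by eventually_elim (intro cdiff_compose, auto)
qed

lemma ball_isCont_subset:
  assumes "isCont g a" "open W" "g a \<in> W"
  obtains d where "d > 0" "g ` ball a d \<subseteq> W"
proof -
  have "\<forall>\<^sub>F v in nhds a. g v \<in> W"
    using assms tendsto_at_iff_tendsto_nhds[of g a] topological_tendstoD
    unfolding isCont_def by blast
  then obtain d where "d > 0" "\<forall>v. dist v a < d \<longrightarrow> g v \<in> W"
    unfolding eventually_nhds_metric by blast
  then show ?thesis
    by (intro that[of d]) (auto simp: dist_commute)
qed

text \<open>The fundamental theorem of calculus for \<phi> on the segment from G v to v: the
  coefficient u_j is the integral of the j-th partial derivative of \<phi> over the segment. Since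
  \<open>a\<close> is fixed, the segment stays near \<open>a\<close> when v does, and u_j is
  holomorphic because the partial derivative is.\<close>

lemma hadamard_difference:
  fixes \<phi> :: "complex ^ 'n::finite \<Rightarrow> complex" and G :: "'n \<Rightarrow> complex ^ 'n \<Rightarrow> complex"
  assumes \<phi>: "cgerm \<phi> a" and G: "\<And>i. cgerm (G i) a" and fixed: "(\<chi> i. G i a) = a"
  shows "\<exists>u. (\<forall>j. cgerm (u j) a) \<and>
    (\<forall>\<^sub>F v in nhds a. \<phi> v - \<phi> (\<chi> i. G i v) = (\<Sum>j\<in>UNIV. u j v * (v $ j - G j v)))"
proof -
  obtain V where V: "open V" "a \<in> V" "\<And>u. u \<in> V \<Longrightarrow> cdiff \<phi> u"
    using \<phi> by (rule cgermE) blast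
  obtain R where R: "R > 0" "ball a R \<subseteq> V"
    using V open_contains_ball by blast
  have "\<forall>\<^sub>F u in nhds a. \<forall>i. cdiff (G i) u"
    using G unfolding cgerm_def by (simp add: eventually_all_finite)
  then obtain d1 where d1: "d1 > 0" "\<And>u i. dist u a < d1 \<Longrightarrow> cdiff (G i) u"
    unfolding eventually_nhds_metric by blast
  have "isCont (\<lambda>u. \<chi> i. G i u) a"
    by (intro isCont_vec_lambda cdiff_imp_isCont cgerm_imp_cdiff G)
  then obtain d2 where d2: "d2 > 0" "(\<lambda>u. \<chi> i. G i u) ` ball a d2 \<subseteq> ball a R"
    by (rule ball_isCont_subset[where W = "ball a R"]) (use R fixed in auto)
  \<comment> \<open>Within \<open>d1\<close> the components of the map are differentiable, within
    \<open>d2\<close> its values lie in the ball of radius \<open>R\<close>, and \<open>d\<close> is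
    at most \<open>R\<close> so that v lies there too; convexity then contains the whole
    segment.\<close>
  define d where "d = min (min d1 d2) R"
  have d: "d > 0" using d1 d2 R by (simp add: d_def)
  define B where "B = ball a d"
  have B: "open B" "convex B" "a \<in> B" using d by (auto simp: B_def)
  have GB: "cdiff (G i) v" if "v \<in> B" for v i
    using that d1(2) by (auto simp: B_def d_def dist_commute)
  define \<gamma> where "\<gamma> t i v = G i v + of_real t * (v $ i - G i v)" for t :: real and i v
  have \<gamma>_alt: "(\<chi> i. \<gamma> t i v) = (1 - t) *\<^sub>R (\<chi> i. G i v) + t *\<^sub>R v" for t v
    by (simp add: \<gamma>_def vec_eq_iff algebra_simps) (simp add: scaleR_conv_of_real algebra_simps)
  have \<gamma>_in: "(\<chi> i. \<gamma> t i v) \<in> ball a R" if "v \<in> B" "t \<in> {0..1}" for t v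
  proof -
    have "v \<in> ball a R" "(\<chi> i. G i v) \<in> ball a R"
      using that(1) d2(2) by (auto simp: B_def d_def image_subset_iff)
    then show ?thesis
      unfolding \<gamma>_alt using that(2) convex_ball[of a R] by (intro convexD) auto
  qed
  have diff\<phi>: "cdiff \<phi> u" if "u \<in> ball a R" for u
    using V(3) R(2) that by blast
  have diff_pd: "cdiff (pd j \<phi>) u" if "u \<in> ball a R" for u j
    by (rule cdiff_pd[OF open_ball diff\<phi> that])
  have \<gamma>_diff: "cdiff (\<gamma> t i) v" "pd k (\<gamma> t i) v = (1 - of_real t) * pd k (G i) v + of_real t * (if k = i then 1 else 0)"
    if "v \<in> B" for t i v k
  proof -
    have eq: "\<gamma> t i = (\<lambda>v. (1 - of_real t) * G i v + of_real t * v $ i)"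
      by (auto simp: \<gamma>_def algebra_simps)
    show "cdiff (\<gamma> t i) v"
      unfolding eq by (intro cdiff_add cdiff_mult cdiff_const cdiff_nth GB that)
    show "pd k (\<gamma> t i) v = (1 - of_real t) * pd k (G i) v + of_real t * (if k = i then 1 else 0)"
      unfolding eq using GB[OF that]
      by (simp add: cdiff_add cdiff_mult cdiff_const cdiff_nth)
  qed
  \<comment> \<open>The chain-rule gradient of the integrand of \<open>u j\<close>; it involves
    second derivatives of \<phi>, which is where \<open>cdiff_pd\<close> enters.\<close>
  define g where "g j k v t = (\<Sum>i\<in>UNIV. pd i (pd j \<phi>) (\<chi> i. \<gamma> t i v) *
      ((1 - of_real t) * pd k (G i) v + of_real t * (if k = i then 1 else 0)))" for j k v and t :: real
  define u where "u j v = integral {0..1} (\<lambda>t. pd j \<phi> (\<chi> i. \<gamma> t i v))" for j v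
  have cont\<gamma>: "continuous_on (B \<times> {0..1}) (\<lambda>y. \<chi> i. \<gamma> (snd y) i (fst y))"
  proof -
    have "continuous_on (B \<times> {0..1}) (\<lambda>y. G i (fst y))" for i
      by (rule continuous_on_compose2[of B "G i"])
        (auto intro!: continuous_at_imp_continuous_on cdiff_imp_isCont GB continuous_on_fst continuous_on_id)
    then show ?thesis
      unfolding \<gamma>_def by (intro continuous_intros)
  qed
  have "cdiff (u j) v" if v: "v \<in> B" for j v
    unfolding u_def
  proof (rule cdiff_integral[where B = B and g = "g j"])
    fix v' and t :: real assume vt: "v' \<in> B" "t \<in> {0..1}"
    have "cdiff (\<lambda>v. pd j \<phi> (\<chi> i. \<gamma> t i v)) v'"
      by (intro cdiff_compose diff_pd \<gamma>_in \<gamma>_diff vt)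
    moreover have "pd k (\<lambda>v. pd j \<phi> (\<chi> i. \<gamma> t i v)) v' = g j k v' t" for k
      unfolding cdiff_compose(2)[OF diff_pd[OF \<gamma>_in[OF vt]] \<gamma>_diff(1)[OF vt(1)]]
      unfolding g_def \<gamma>_diff(2)[OF vt(1)] ..
    ultimately show "((\<lambda>v. pd j \<phi> (\<chi> i. \<gamma> t i v)) has_derivative (\<lambda>w. \<Sum>i\<in>UNIV. g j i v' t * w $ i)) (at v')"
      using cdiff_has_derivative by fastforce
  next
    fix k
    have "continuous_on (B \<times> {0..1}) (\<lambda>y. pd i (pd j \<phi>) (\<chi> i. \<gamma> (snd y) i (fst y)))" for i
      by (rule continuous_on_compose2[OF continuous_on_pd[OF open_ball[of a R] diff_pd] cont\<gamma>])
        (use \<gamma>_in in auto)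
    moreover have "continuous_on (B \<times> {0..1}) (\<lambda>y. pd k (G i) (fst y))" for i
      by (rule continuous_on_compose2[OF continuous_on_pd[OF B(1) GB]])
        (auto intro!: continuous_intros)
    ultimately show "continuous_on (B \<times> {0..1}) (\<lambda>(v, t). g j k v t)"
      unfolding g_def split_def by (intro continuous_intros)
  next
    fix v' assume "v' \<in> B"
    have "continuous_on (B \<times> {0..1}) (\<lambda>y. pd j \<phi> (\<chi> i. \<gamma> (snd y) i (fst y)))"
      by (rule continuous_on_compose2[OF continuous_on_pd[OF open_ball[of a R] diff\<phi>] cont\<gamma>])
        (use \<gamma>_in in auto)
    then show "continuous_on {0..1} (\<lambda>t. pd j \<phi> (\<chi> i. \<gamma> t i v'))"
      using continuous_on_slice[of B "{0..1}" "\<lambda>v t. pd j \<phi> (\<chi> i. \<gamma> t i v)" v'] \<open>v' \<in> B\<close>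
      by (simp add: split_def)
  qed (use B v in auto)
  then have u_germ: "cgerm (u j) a" for j
    unfolding cgerm_def eventually_nhds using B by blast
  \<comment> \<open>The parameter t = 0 gives the image point and t = 1 gives v itself.\<close>
  have diff_eq: "\<phi> v - \<phi> (\<chi> i. G i v) = (\<Sum>j\<in>UNIV. u j v * (v $ j - G j v))" if v: "v \<in> B" for v
  proof -
    have der: "((\<lambda>t. \<phi> (\<chi> i. \<gamma> t i v)) has_vector_derivative
        (\<Sum>j\<in>UNIV. pd j \<phi> (\<chi> i. \<gamma> t i v) * (v $ j - G j v))) (at t within {0..1})" if t: "t \<in> {0..1}" for t
    proof -
      have "((\<lambda>t. \<chi> i. \<gamma> t i v) has_derivative (\<lambda>h. \<chi> i. of_real h * (v $ i - G i v))) (at t)"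
        unfolding \<gamma>_def by (intro has_derivative_vec_lambda) (auto intro!: derivative_eq_intros)
      from has_derivative_compose[OF this cdiff_has_derivative[OF diff\<phi>[OF \<gamma>_in[OF v t]]]]
      have "((\<lambda>t. \<phi> (\<chi> i. \<gamma> t i v)) has_derivative
         (\<lambda>h. \<Sum>j\<in>UNIV. pd j \<phi> (\<chi> i. \<gamma> t i v) * (of_real h * (v $ j - G j v)))) (at t)"
        by simp
      moreover have "(\<lambda>h :: real. \<Sum>j\<in>UNIV. pd j \<phi> (\<chi> i. \<gamma> t i v) * (of_real h * (v $ j - G j v))) =
          (\<lambda>h. h *\<^sub>R (\<Sum>j\<in>UNIV. pd j \<phi> (\<chi> i. \<gamma> t i v) * (v $ j - G j v)))"
        by (simp only: scaleR_conv_of_real sum_distrib_left mult.left_commute)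
      ultimately show ?thesis
        unfolding has_vector_derivative_def using has_derivative_at_withinI by fastforce
    qed
    have "((\<lambda>t. \<Sum>j\<in>UNIV. pd j \<phi> (\<chi> i. \<gamma> t i v) * (v $ j - G j v)) has_integral
        (\<phi> (\<chi> i. \<gamma> 1 i v) - \<phi> (\<chi> i. \<gamma> 0 i v))) {0..1}"
      by (rule fundamental_theorem_of_calculus[OF _ der]) auto
    moreover have "(\<chi> i. \<gamma> 1 i v) = v" "(\<chi> i. \<gamma> 0 i v) = (\<chi> i. G i v)"
      by (simp_all add: \<gamma>_def vec_eq_iff)
    ultimately have "\<phi> v - \<phi> (\<chi> i. G i v) =
        integral {0..1} (\<lambda>t. \<Sum>j\<in>UNIV. pd j \<phi> (\<chi> i. \<gamma> t i v) * (v $ j - G j v))"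
      by (simp add: integral_unique)
    also have "\<dots> = (\<Sum>j\<in>UNIV. integral {0..1} (\<lambda>t. pd j \<phi> (\<chi> i. \<gamma> t i v) * (v $ j - G j v)))"
    proof (intro integral_sum integrable_continuous_real continuous_intros)
      fix j
      have "continuous_on (B \<times> {0..1}) (\<lambda>y. pd j \<phi> (\<chi> i. \<gamma> (snd y) i (fst y)))"
        by (rule continuous_on_compose2[OF continuous_on_pd[OF open_ball[of a R] diff\<phi>] cont\<gamma>])
          (use \<gamma>_in in auto)
      then show "continuous_on {0..1} (\<lambda>t. pd j \<phi> (\<chi> i. \<gamma> t i v))"
        using continuous_on_slice[of B "{0..1}" "\<lambda>v t. pd j \<phi> (\<chi> i. \<gamma> t i v)" v] v
        by (simp add: split_def)
    qed auto
    finally show ?thesis by (simp add: u_def)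
  qed
  have "\<forall>\<^sub>F v in nhds a. \<phi> v - \<phi> (\<chi> i. G i v) = (\<Sum>j\<in>UNIV. u j v * (v $ j - G j v))"
    using eventually_nhds_in_open[OF B(1,3)] by eventually_elim (rule diff_eq)
  with u_germ show ?thesis by (intro exI[of _ u] conjI allI)
qed


section \<open>Germs in a chart\<close>

lemma inv_chart:
  assumes "topological_chart U x" "q \<in> U"
  shows "inv_into U x (x q) = q"
  using assms by (auto simp: topological_chart_def homeomorphism_def)

lemma chart_open_image:
  assumes "topological_chart U x" "open W"
  shows "open (x ` (U \<inter> W))"
proof -
  have "continuous_on (x ` U) (inv_into U x)" "open (x ` U)"
    using assms(1) by (auto simp: topological_chart_def homeomorphism_def)
  then have "open (x ` U \<inter> inv_into U x -` W)"
    using assms(2) by (simp add: continuous_open_preimage)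
  moreover have "x ` U \<inter> inv_into U x -` W = x ` (U \<inter> W)"
    using inv_chart[OF assms(1)] by auto
  ultimately show ?thesis by simp
qed

lemma isCont_chart:
  assumes "topological_chart U x" "q \<in> U"
  shows "isCont x q" "isCont (inv_into U x) (x q)"
  using assms
  by (auto simp: topological_chart_def homeomorphism_def continuous_on_eq_continuous_at)

text \<open>Chart and inverse are continuous at corresponding points. Every statement about germs on
  the manifold is moved to coordinate space and back by this equivalence.\<close>

lemma eventually_chart:
  assumes chart: "topological_chart U x" and q: "q \<in> U"
  shows "(\<forall>\<^sub>F y in nhds q. P y) \<longleftrightarrow> (\<forall>\<^sub>F v in nhds (x q). P (inv_into U x v))"
proof
  assume P: "\<forall>\<^sub>F y in nhds q. P y"
  have "filterlim (inv_into U x) (nhds q) (nhds (x q))"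
    using isCont_chart(2)[OF assms] tendsto_at_iff_tendsto_nhds[of "inv_into U x" "x q"]
    by (simp add: isCont_def inv_chart[OF assms])
  from eventually_compose_filterlim[OF P this]
  show "\<forall>\<^sub>F v in nhds (x q). P (inv_into U x v)" .
next
  assume P: "\<forall>\<^sub>F v in nhds (x q). P (inv_into U x v)"
  have "filterlim x (nhds (x q)) (nhds q)"
    using isCont_chart(1)[OF assms] tendsto_at_iff_tendsto_nhds[of x q] by (simp add: isCont_def)
  from eventually_compose_filterlim[OF P this]
  have "\<forall>\<^sub>F y in nhds q. P (inv_into U x (x y))" .
  moreover have "\<forall>\<^sub>F y in nhds q. y \<in> U"
    using chart q by (intro eventually_nhds_in_open) (auto simp: topological_chart_def)
  ultimately show "\<forall>\<^sub>F y in nhds q. P y"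
    by eventually_elim (simp add: inv_chart[OF chart])
qed

lemma holo_fun_iff: "holo_fun F V \<longleftrightarrow> open V \<and> (\<forall>v\<in>V. cdiff F v)"
  by (simp add: holo_fun_def cdiff_def)

lemma holo_fun_imp_cgerm: "holo_fun F V \<Longrightarrow> v \<in> V \<Longrightarrow> cgerm F v"
  unfolding holo_fun_iff cgerm_def eventually_nhds by blast

text \<open>The base point need not be the coordinate origin, so the same chart yields an instance
  at every nearby point. That is how a rule proved at \<open>p\<close> becomes an identity of
  germs.\<close>

locale chart_at =
  fixes A :: "('a::t2_space, 'n::finite) atlas" and U :: "'a set" and x :: "'a \<Rightarrow> complex ^ 'n" and p :: 'a
  assumes manifold: "complex_manifold A" and holo: "holo_chart A U x" and base: "p \<in> U"
begin

lemma top_chart: "topological_chart U x"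
  using holo by (simp add: holo_chart_def)

lemma open_domain: "open U"
  using top_chart by (simp add: topological_chart_def)

lemma inv_coord: "q \<in> U \<Longrightarrow> inv_into U x (x q) = q"
  by (rule inv_chart[OF top_chart])

lemma eventually_coord:
  "(\<forall>\<^sub>F y in nhds p. P y) \<longleftrightarrow> (\<forall>\<^sub>F v in nhds (x p). P (inv_into U x v))"
  by (rule eventually_chart[OF top_chart base])

lemma eventually_domain: "\<forall>\<^sub>F y in nhds p. y \<in> U"
  by (rule eventually_nhds_in_open[OF open_domain base])

lemma eventually_coord_inv: "\<forall>\<^sub>F v in nhds (x p). x (inv_into U x v) = v"
proof -
  have "open (x ` U)" "x p \<in> x ` U"
    using top_chart base by (auto simp: topological_chart_def)
  from eventually_nhds_in_open[OF this] show ?thesis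
    by eventually_elim (simp add: f_inv_into_f)
qed

lemma chart_at_eventually: "\<forall>\<^sub>F y in nhds p. chart_at A U x y"
  using eventually_domain by eventually_elim (unfold_locales, simp_all add: manifold holo)

lemma atlas_chart_exists:
  obtains V w where "(V, w) \<in> A" "chart_at A V w p" "\<And>i. holo_fun (\<lambda>v. x (inv_into V w v) $ i) (w ` (V \<inter> U))"
    "\<And>i. holo_fun (\<lambda>v. w (inv_into U x v) $ i) (x ` (U \<inter> V))"
proof -
  have "p \<in> (\<Union>(U, z)\<in>A. U)"
    using manifold by (auto simp: complex_manifold_def)
  then obtain V w where Vw: "(V, w) \<in> A" "p \<in> V" by blast
  with manifold holo have "chart_at A V w p" "holo_transition U x V w \<and> holo_transition V w U x"
    by (auto simp: complex_manifold_def holo_chart_def chart_at_def)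
  with Vw that show ?thesis
    by (auto simp: holo_transition_def)
qed

text \<open>\<open>hol_on\<close> tests all charts of the atlas, while \<open>(U, x)\<close> is any
  member of the maximal atlas. The transition maps are holomorphic in both directions, so by the
  chain rule this one chart decides.\<close>

lemma hol_at_iff: "hol_at A p h \<longleftrightarrow> cgerm (\<lambda>v. h (inv_into U x v)) (x p)"
proof
  assume "hol_at A p h"
  then obtain W where W: "p \<in> W" "hol_on A W h" by (auto simp: hol_at_def)
  obtain V w where Vw: "(V, w) \<in> A" "chart_at A V w p"
    and trans: "\<And>i. holo_fun (\<lambda>v. w (inv_into U x v) $ i) (x ` (U \<inter> V))"
    by (rule atlas_chart_exists) blast
  interpret V: chart_at A V w p by fact
  have "holo_fun (\<lambda>v. h (inv_into V w v)) (w ` (V \<inter> W))"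
    using W Vw by (auto simp: hol_on_def)
  then have "cgerm (\<lambda>v. h (inv_into V w v)) (w p)"
    using W V.base by (intro holo_fun_imp_cgerm) auto
  moreover have "cgerm (\<lambda>v. w (inv_into U x v) $ i) (x p)" for i
    using base V.base by (intro holo_fun_imp_cgerm[OF trans]) auto
  ultimately have "cgerm (\<lambda>v. h (inv_into V w (\<chi> i. w (inv_into U x v) $ i))) (x p)"
    by (intro cgerm_compose) (simp_all add: vec_lambda_eta inv_coord base)
  moreover have "\<forall>\<^sub>F v in nhds (x p). h (inv_into V w (\<chi> i. w (inv_into U x v) $ i)) = h (inv_into U x v)"
    using V.eventually_domain unfolding eventually_coord
    by eventually_elim (simp add: vec_lambda_eta V.inv_coord)
  ultimately show "cgerm (\<lambda>v. h (inv_into U x v)) (x p)"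
    by (rule cgerm_cong)
next
  assume "cgerm (\<lambda>v. h (inv_into U x v)) (x p)"
  then obtain V0 where V0: "open V0" "x p \<in> V0" "\<And>v. v \<in> V0 \<Longrightarrow> cdiff (\<lambda>v. h (inv_into U x v)) v"
    by (rule cgermE) blast
  \<comment> \<open>An open set on which \<open>h\<close> is differentiable in the given chart; each
    chart of the atlas then has to be checked on its intersection with \<open>W\<close>.\<close>
  define W where "W = U \<inter> x -` V0"
  have openW: "open W"
    using top_chart V0(1) unfolding W_def
    by (intro continuous_open_preimage) (auto simp: topological_chart_def homeomorphism_def)
  have "holo_fun (\<lambda>v. h (inv_into V w v)) (w ` (V \<inter> W))" if Vw: "(V, w) \<in> A" for V w
    unfolding holo_fun_iff
  proof (intro conjI ballI)
    have top: "topological_chart V w"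
      using manifold Vw by (auto simp: complex_manifold_def holo_chart_def)
    show opn: "open (w ` (V \<inter> W))"
      by (rule chart_open_image[OF top openW])
    have trans: "cdiff (\<lambda>v. x (inv_into V w v) $ i) v" if "v \<in> w ` (V \<inter> U)" for v i
      using holo Vw that by (auto simp: holo_chart_def holo_transition_def holo_fun_iff)
    fix v assume v: "v \<in> w ` (V \<inter> W)"
    have "cdiff (\<lambda>v. h (inv_into U x (\<chi> i. x (inv_into V w v) $ i))) v"
      using v inv_chart[OF top] by (intro cdiff_compose V0 trans) (auto simp: W_def vec_lambda_eta)
    moreover have "\<forall>\<^sub>F v in nhds v. h (inv_into U x (\<chi> i. x (inv_into V w v) $ i)) = h (inv_into V w v)"
      using eventually_nhds_in_open[OF opn v]
      by eventually_elim (auto simp: W_def vec_lambda_eta inv_coord inv_chart[OF top])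
    ultimately show "cdiff (\<lambda>v. h (inv_into V w v)) v"
      by (rule cdiff_cong)
  qed
  then show "hol_at A p h"
    unfolding hol_at_def hol_on_def using openW V0(2) base by (auto simp: W_def intro!: exI[of _ W])
qed

lemma hol_at_cong:
  assumes "hol_at A p h" "\<forall>\<^sub>F q in nhds p. h q = h' q"
  shows "hol_at A p h'"
  using assms unfolding hol_at_iff eventually_coord by (rule cgerm_cong)

lemma hol_at_isCont:
  assumes "hol_at A p h" shows "isCont h p"
proof -
  have "isCont (\<lambda>y. h (inv_into U x (x y))) p"
    using assms isCont_chart[OF top_chart base] isCont_o2[of p x "\<lambda>v. h (inv_into U x v)"]
    unfolding hol_at_iff by (auto dest: cgerm_imp_cdiff cdiff_imp_isCont)
  moreover have "\<forall>\<^sub>F y in nhds p. h (inv_into U x (x y)) = h y"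
    using eventually_domain by eventually_elim (simp add: inv_coord)
  ultimately show ?thesis
    by (simp add: isCont_cong)
qed

section \<open>The ring of germs\<close>

lemma hol_at_const: "hol_at A p (\<lambda>q. c)"
  unfolding hol_at_iff cgerm_def by (intro always_eventually allI cdiff_const)

lemma hol_at_add: "hol_at A p h \<Longrightarrow> hol_at A p k \<Longrightarrow> hol_at A p (\<lambda>q. h q + k q)"
  unfolding hol_at_iff cgerm_def by (erule (1) eventually_elim2) (rule cdiff_add)

lemma hol_at_mult: "hol_at A p h \<Longrightarrow> hol_at A p k \<Longrightarrow> hol_at A p (\<lambda>q. h q * k q)"
  unfolding hol_at_iff cgerm_def by (erule (1) eventually_elim2) (rule cdiff_mult)

lemma hol_at_diff:
  assumes "hol_at A p h" "hol_at A p k" shows "hol_at A p (\<lambda>q. h q - k q)"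
  using hol_at_add[OF assms(1) hol_at_mult[OF hol_at_const[of "-1"] assms(2)]] by simp

lemma hol_at_sum: "(\<And>i. i \<in> I \<Longrightarrow> hol_at A p (h i)) \<Longrightarrow> hol_at A p (\<lambda>q. \<Sum>i\<in>I. h i q)"
  by (induction I rule: infinite_finite_induct) (auto intro: hol_at_const hol_at_add)

lemma hol_at_prod: "(\<And>i. i \<in> I \<Longrightarrow> hol_at A p (h i)) \<Longrightarrow> hol_at A p (\<lambda>q. \<Prod>i\<in>I. h i q)"
  by (induction I rule: infinite_finite_induct) (auto intro: hol_at_const hol_at_mult)

lemma hol_at_power: "hol_at A p h \<Longrightarrow> hol_at A p (\<lambda>q. h q ^ m)"
  by (induction m) (auto intro: hol_at_const hol_at_mult)

lemma eventually_nonzero: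
  assumes "hol_at A p h" "h p \<noteq> 0" shows "\<forall>\<^sub>F q in nhds p. h q \<noteq> 0"
  using hol_at_isCont[OF assms(1)] tendsto_at_iff_tendsto_nhds[of h p] assms(2)
  by (auto simp: isCont_def intro: tendsto_imp_eventually_ne)

lemma hol_at_divide:
  assumes "hol_at A p h" "hol_at A p k" "k p \<noteq> 0" shows "hol_at A p (\<lambda>q. h q / k q)"
proof -
  have "hol_at A p (\<lambda>q. inverse (k q))"
    using assms(2) eventually_nonzero[OF assms(2,3)] unfolding hol_at_iff eventually_coord cgerm_def
    by eventually_elim (rule cdiff_inverse)
  from hol_at_mult[OF assms(1) this] show ?thesis by (simp add: divide_inverse)
qed

lemma hol_at_coord: "hol_at A p (\<lambda>q. x q $ i)"
proof -
  have "cgerm (\<lambda>v. v $ i) (x p)"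
    by (simp add: cgerm_def cdiff_nth)
  moreover have "\<forall>\<^sub>F v in nhds (x p). v $ i = x (inv_into U x v) $ i"
    using eventually_coord_inv by eventually_elim simp
  ultimately show ?thesis
    unfolding hol_at_iff by (rule cgerm_cong)
qed

section \<open>Coordinate derivatives of germs and pull-back along the map\<close>

lemma coord_deriv_eq: "coord_deriv U x j h q = pd j (\<lambda>v. h (inv_into U x v)) (x q)"
  by (simp add: coord_deriv_def pd_def)

lemma coord_deriv_cong:
  assumes "\<forall>\<^sub>F q in nhds p. h q = h' q"
  shows "\<forall>\<^sub>F q in nhds p. coord_deriv U x j h q = coord_deriv U x j h' q"
proof -
  have "\<forall>\<^sub>F q in nhds p. \<forall>\<^sub>F y in nhds q. h y = h' y"
    using assms by (simp add: eventually_eventually)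
  then show ?thesis
    using chart_at_eventually
  proof eventually_elim
    case (elim q)
    interpret q: chart_at A U x q by (rule elim)
    show ?case
      unfolding coord_deriv_eq by (rule pd_cong) (use elim(1) in \<open>simp add: q.eventually_coord\<close>)
  qed
qed

lemma hol_at_coord_deriv:
  assumes "hol_at A p h" shows "hol_at A p (coord_deriv U x j h)"
proof -
  have "cgerm (pd j (\<lambda>v. h (inv_into U x v))) (x p)"
    using assms unfolding hol_at_iff by (rule cgerm_pd)
  moreover have "\<forall>\<^sub>F v in nhds (x p). pd j (\<lambda>v. h (inv_into U x v)) v = coord_deriv U x j h (inv_into U x v)"
    using eventually_coord_inv by eventually_elim (simp add: coord_deriv_eq)
  ultimately show ?thesis
    unfolding hol_at_iff by (rule cgerm_cong)
qed

lemma hol_at_eventually: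
  assumes "hol_at A p h" shows "\<forall>\<^sub>F q in nhds p. hol_at A q h"
proof -
  have "\<forall>\<^sub>F v in nhds (x p). cgerm (\<lambda>v. h (inv_into U x v)) v"
    using assms by (simp add: hol_at_iff cgerm_def eventually_eventually)
  then have "\<forall>\<^sub>F v in nhds (x p). cgerm (\<lambda>v. h (inv_into U x v)) (x (inv_into U x v))"
    using eventually_coord_inv by eventually_elim simp
  then have "\<forall>\<^sub>F q in nhds p. cgerm (\<lambda>v. h (inv_into U x v)) (x q)"
    by (simp add: eventually_coord)
  then show ?thesis
    using chart_at_eventually by eventually_elim (simp add: chart_at.hol_at_iff)
qed

lemma coord_deriv_add:
  assumes "hol_at A p h" "hol_at A p k"
  shows "coord_deriv U x j (\<lambda>q. h q + k q) p = coord_deriv U x j h p + coord_deriv U x j k p"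
  using assms unfolding hol_at_iff coord_deriv_eq by (intro cdiff_add cgerm_imp_cdiff)

lemma coord_deriv_mult:
  assumes "hol_at A p h" "hol_at A p k"
  shows "coord_deriv U x j (\<lambda>q. h q * k q) p = coord_deriv U x j h p * k p + h p * coord_deriv U x j k p"
  using assms cdiff_mult(2)[of "\<lambda>v. h (inv_into U x v)" "x p" "\<lambda>v. k (inv_into U x v)" j]
  unfolding hol_at_iff coord_deriv_eq by (simp add: cgerm_imp_cdiff inv_coord base)

lemma coord_deriv_const: "coord_deriv U x j (\<lambda>q. c) q = 0"
  by (simp add: coord_deriv_def)

lemma coord_deriv_coord: "coord_deriv U x j (\<lambda>q. x q $ i) p = (if j = i then 1 else 0)"
proof -
  have "\<forall>\<^sub>F v in nhds (x p). x (inv_into U x v) $ i = v $ i"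
    using eventually_coord_inv by eventually_elim simp
  from pd_cong[OF this, of j] show ?thesis
    unfolding coord_deriv_eq by (simp add: cdiff_nth)
qed

lemma eventually_map_in:
  assumes "holo_self_map A f" "f p = p" "open W" "p \<in> W"
  shows "\<forall>\<^sub>F q in nhds p. f q \<in> W"
proof -
  have "isCont f p"
    using assms(1) by (simp add: holo_self_map_def continuous_on_eq_continuous_at)
  then have "filterlim f (nhds p) (nhds p)"
    using tendsto_at_iff_tendsto_nhds[of f p] assms(2) by (simp add: isCont_def)
  from eventually_compose_filterlim[OF eventually_nhds_in_open[OF assms(3,4)] this] show ?thesis .
qed

text \<open>\<open>holo_self_map\<close> speaks of charts of the atlas on both sides; since
  \<open>f p = p\<close>, one such chart around \<open>p\<close> serves as source and
  target.\<close>

lemma hol_at_comp_map: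
  assumes f: "holo_self_map A f" "f p = p" and h: "hol_at A p h"
  shows "hol_at A p (\<lambda>q. h (f q))"
proof -
  obtain V w where Vw: "(V, w) \<in> A" "chart_at A V w p"
    by (rule atlas_chart_exists) blast
  interpret V: chart_at A V w p by fact
  have "holo_fun (\<lambda>v. w (f (inv_into V w v)) $ i) (w ` (V \<inter> f -` V))" for i
    using f(1) Vw(1) unfolding holo_self_map_def by fast
  then have "cgerm (\<lambda>v. w (f (inv_into V w v)) $ i) (w p)" for i
    by (rule holo_fun_imp_cgerm) (use V.base f(2) in auto)
  moreover have "cgerm (\<lambda>v. h (inv_into V w v)) (w p)"
    using h by (simp add: V.hol_at_iff)
  ultimately have "cgerm (\<lambda>v. h (inv_into V w (\<chi> i. w (f (inv_into V w v)) $ i))) (w p)"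
    by (intro cgerm_compose) (simp_all add: vec_lambda_eta V.inv_coord V.base f(2))
  moreover have "\<forall>\<^sub>F q in nhds p. f q \<in> V"
    by (rule eventually_map_in[OF f V.open_domain V.base])
  then have "\<forall>\<^sub>F v in nhds (w p). h (inv_into V w (\<chi> i. w (f (inv_into V w v)) $ i)) = h (f (inv_into V w v))"
    unfolding V.eventually_coord by eventually_elim (simp add: vec_lambda_eta V.inv_coord)
  ultimately show ?thesis
    unfolding V.hol_at_iff by (rule cgerm_cong)
qed

end


section \<open>Residues and the fixed-point ideal\<close>

lemma count_list_concat_replicate:
  "distinct l \<Longrightarrow> count_list (concat (map (replicate N) l)) i = (if i \<in> set l then N else 0)"
proof (induction l)
  case (Cons a l)
  have "count_list (replicate m a) i = (if i = a then m else 0)" for m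
    by (induction m) auto
  with Cons show ?case by auto
qed simp

lemma foldr_concat_replicate:
  "foldr F (concat (map (replicate N) l)) h = foldr (\<lambda>j. F j ^^ N) l h"
proof (induction l)
  case (Cons a l)
  have "foldr F (replicate m a) k = (F a ^^ m) k" for m k
    by (induction m) auto
  with Cons show ?case by simp
qed simp

text \<open>Flattens the nested iteration into one list of directions in which every index occurs N
  times, so that properties of Taylor coefficients follow by list induction. The \<open>SOME\<close>
  in the definition is hidden here once and for all.\<close>

lemma taylor_coeff_foldr:
  fixes x :: "'a \<Rightarrow> complex ^ 'n::finite"
  obtains js :: "'n list" where "\<And>i. count_list js i = N"
    and "\<And>h. taylor_coeff U x p N h = foldr (coord_deriv U x) js h p / fact N ^ CARD('n)"
proof -
  define l where "l = (SOME l :: 'n list. distinct l \<and> set l = UNIV)"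
  have "\<exists>l :: 'n list. distinct l \<and> set l = UNIV"
    using finite_distinct_list[of "UNIV :: 'n set"] by auto
  then have "distinct l \<and> set l = UNIV"
    unfolding l_def by (rule someI_ex)
  then show ?thesis
    by (intro that[of "concat (map (replicate N) l)"])
      (simp_all add: count_list_concat_replicate foldr_concat_replicate taylor_coeff_def l_def[symmetric])
qed

section \<open>Iterated derivatives and Taylor coefficients\<close>

context chart_at
begin

abbreviation iter_deriv :: "'n list \<Rightarrow> ('a \<Rightarrow> complex) \<Rightarrow> 'a \<Rightarrow> complex" where
  "iter_deriv js \<equiv> foldr (coord_deriv U x) js"

text \<open>Stated near \<open>p\<close> and not just at \<open>p\<close>: an equality of values at
  one point would not survive the next differentiation. The same holds for the rules below.\<close>

lemma iter_deriv_cong: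
  "\<forall>\<^sub>F q in nhds p. h q = h' q \<Longrightarrow> \<forall>\<^sub>F q in nhds p. iter_deriv js h q = iter_deriv js h' q"
  by (induction js) (auto intro: coord_deriv_cong)

lemma hol_at_iter_deriv: "hol_at A p h \<Longrightarrow> hol_at A p (iter_deriv js h)"
  by (induction js) (auto intro: hol_at_coord_deriv)

lemma eventually_coord_deriv_add:
  assumes "hol_at A p h" "hol_at A p k"
  shows "\<forall>\<^sub>F q in nhds p. coord_deriv U x j (\<lambda>q. h q + k q) q = coord_deriv U x j h q + coord_deriv U x j k q"
  using assms[THEN hol_at_eventually] chart_at_eventually
  by eventually_elim (rule chart_at.coord_deriv_add)

lemma eventually_coord_deriv_mult:
  assumes "hol_at A p h" "hol_at A p k"
  shows "\<forall>\<^sub>F q in nhds p. coord_deriv U x j (\<lambda>q. h q * k q) q = coord_deriv U x j h q * k q + h q * coord_deriv U x j k q"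
  using assms[THEN hol_at_eventually] chart_at_eventually
  by eventually_elim (rule chart_at.coord_deriv_mult)

lemma iter_deriv_add:
  assumes "hol_at A p h" "hol_at A p k"
  shows "\<forall>\<^sub>F q in nhds p. iter_deriv js (\<lambda>q. h q + k q) q = iter_deriv js h q + iter_deriv js k q"
proof (induction js)
  case (Cons j js)
  from coord_deriv_cong[OF this, of j]
    eventually_coord_deriv_add[OF assms[THEN hol_at_iter_deriv[of _ js]], of j]
  show ?case by eventually_elim simp
qed simp

lemma iter_deriv_cmult:
  assumes "hol_at A p h"
  shows "\<forall>\<^sub>F q in nhds p. iter_deriv js (\<lambda>q. c * h q) q = c * iter_deriv js h q"
proof (induction js)
  case (Cons j js)
  from coord_deriv_cong[OF this, of j]
    eventually_coord_deriv_mult[OF hol_at_const[of c] hol_at_iter_deriv[OF assms, of js], of j]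
  show ?case by eventually_elim (simp add: coord_deriv_const)
qed simp

text \<open>Order of vanishing along a coordinate hyperplane, expressed by divisibility; it replaces
  an argument with power series.\<close>

definition coord_div :: "'n \<Rightarrow> nat \<Rightarrow> ('a \<Rightarrow> complex) \<Rightarrow> bool" where
  "coord_div i m h \<longleftrightarrow> (\<exists>v. hol_at A p v \<and> (\<forall>\<^sub>F q in nhds p. h q = v q * x q $ i ^ m))"

text \<open>For m = 0 the truncated exponent is harmless, because the factor \<open>of_nat m\<close>
  vanishes.\<close>

lemma coord_deriv_coord_power:
  "coord_deriv U x j (\<lambda>q. x q $ i ^ m) p = (if j = i then of_nat m * x p $ i ^ (m - 1) else 0)"
proof (induction m)
  case (Suc m)
  have "coord_deriv U x j (\<lambda>q. x q $ i * x q $ i ^ m) p =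
      coord_deriv U x j (\<lambda>q. x q $ i) p * x p $ i ^ m + x p $ i * coord_deriv U x j (\<lambda>q. x q $ i ^ m) p"
    by (intro coord_deriv_mult hol_at_coord hol_at_power)
  with Suc show ?case
    by (cases m) (auto simp: coord_deriv_coord algebra_simps)
qed (simp add: coord_deriv_const)

text \<open>By the product rule, a derivative in direction \<open>i\<close> costs one power of the
  i-th coordinate and a derivative in any other direction costs none.\<close>

lemma coord_div_coord_deriv:
  assumes "coord_div i m h" "j = i \<Longrightarrow> m > 0"
  shows "coord_div i (if j = i then m - 1 else m) (coord_deriv U x j h)"
proof -
  obtain v where v: "hol_at A p v" "\<forall>\<^sub>F q in nhds p. h q = v q * x q $ i ^ m"
    using assms(1) by (auto simp: coord_div_def)
  have "\<forall>\<^sub>F q in nhds p. coord_deriv U x j h q = coord_deriv U x j v q * x q $ i ^ m +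
      v q * coord_deriv U x j (\<lambda>q. x q $ i ^ m) q"
    using coord_deriv_cong[OF v(2), of j] eventually_coord_deriv_mult[OF v(1) hol_at_power[OF hol_at_coord], of j i m]
    by eventually_elim simp
  then have *: "\<forall>\<^sub>F q in nhds p. coord_deriv U x j h q = coord_deriv U x j v q * x q $ i ^ m +
      v q * (if j = i then of_nat m * x q $ i ^ (m - 1) else 0)"
    using chart_at_eventually by eventually_elim (simp add: chart_at.coord_deriv_coord_power)
  show ?thesis
  proof (cases "j = i")
    case True
    obtain m' where m: "m = Suc m'" using assms(2) True by (cases m) auto
    have "\<forall>\<^sub>F q in nhds p. coord_deriv U x j h q =
        (coord_deriv U x j v q * x q $ i + of_nat m * v q) * x q $ i ^ m'"
      using * by eventually_elim (simp add: True m algebra_simps)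
    then show ?thesis
      unfolding coord_div_def using v(1) True m
      by (intro exI[of _ "\<lambda>q. coord_deriv U x j v q * x q $ i + of_nat m * v q"])
        (auto intro!: hol_at_add hol_at_mult hol_at_const hol_at_coord hol_at_coord_deriv)
  next
    case False
    with * show ?thesis
      unfolding coord_div_def using v(1)
      by (intro exI[of _ "coord_deriv U x j v"]) (auto intro!: hol_at_coord_deriv)
  qed
qed

lemma coord_div_iter_deriv:
  "coord_div i m h \<Longrightarrow> count_list js i \<le> m \<Longrightarrow> coord_div i (m - count_list js i) (iter_deriv js h)"
proof (induction js)
  case (Cons j js)
  then have "coord_div i (m - count_list js i) (iter_deriv js h)"
    by (auto split: if_splits)
  from coord_div_coord_deriv[OF this, of j] Cons.prems(2) show ?case
    by (auto split: if_splits)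
qed simp

lemma taylor_coeff_cong:
  assumes "\<forall>\<^sub>F q in nhds p. h q = h' q"
  shows "taylor_coeff U x p N h = taylor_coeff U x p N h'"
  by (rule taylor_coeff_foldr[of N U x p])
    (simp add: eventually_nhds_x_imp_x[OF iter_deriv_cong[OF assms]])

lemma taylor_coeff_add:
  assumes "hol_at A p h" "hol_at A p k"
  shows "taylor_coeff U x p N (\<lambda>q. h q + k q) = taylor_coeff U x p N h + taylor_coeff U x p N k"
  by (rule taylor_coeff_foldr[of N U x p])
    (simp add: eventually_nhds_x_imp_x[OF iter_deriv_add[OF assms]] add_divide_distrib)

lemma taylor_coeff_cmult:
  assumes "hol_at A p h"
  shows "taylor_coeff U x p N (\<lambda>q. c * h q) = c * taylor_coeff U x p N h"
  by (rule taylor_coeff_foldr[of N U x p])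
    (simp add: eventually_nhds_x_imp_x[OF iter_deriv_cmult[OF assms]])

lemma taylor_coeff_zero: "taylor_coeff U x p N (\<lambda>q. 0) = 0"
  using taylor_coeff_cmult[OF hol_at_const[of 0], of N 0] by simp

lemma taylor_coeff_sum:
  assumes "\<And>i. i \<in> I \<Longrightarrow> hol_at A p (h i)"
  shows "taylor_coeff U x p N (\<lambda>q. \<Sum>i\<in>I. h i q) = (\<Sum>i\<in>I. taylor_coeff U x p N (h i))"
  using assms
  by (induction I rule: infinite_finite_induct)
    (simp_all add: taylor_coeff_zero taylor_coeff_add hol_at_sum)

text \<open>The coefficient uses exactly N derivatives in direction \<open>i\<close>; from N + 1
  factors one remains, and it vanishes at \<open>p\<close>.\<close>

lemma taylor_coeff_coord_div:
  assumes "coord_div i (Suc N) h" "x p $ i = 0"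
  shows "taylor_coeff U x p N h = 0"
proof (rule taylor_coeff_foldr[of N U x p])
  fix js :: "'n list"
  assume js: "\<And>i. count_list js i = N"
    "\<And>h. taylor_coeff U x p N h = foldr (coord_deriv U x) js h p / fact N ^ CARD('n)"
  have "coord_div i (Suc N - N) (iter_deriv js h)"
    using coord_div_iter_deriv[OF assms(1), of js] js(1) by simp
  then obtain v where "\<forall>\<^sub>F q in nhds p. iter_deriv js h q = v q * x q $ i"
    by (auto simp: coord_div_def)
  from eventually_nhds_x_imp_x[OF this] assms(2) js(2) show ?thesis
    by simp
qed

end

text \<open>Intended for two instances at the same fixed point, one for the residue coordinates and
  one for the adapted coordinates; both charts are centred.\<close>

locale fixed_point_chart = chart_at A U x p
  for A :: "('a::t2_space, 'n::finite) atlas" and U and x and p and f :: "'a \<Rightarrow> 'a" +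
  assumes self_map: "holo_self_map A f" and fixed: "f p = p" and centred: "x p = 0"
begin

abbreviation fix_ideal :: "('a \<Rightarrow> complex) set" where
  "fix_ideal \<equiv> fixed_ideal A f p x"

lemma hol_at_comp: "hol_at A p h \<Longrightarrow> hol_at A p (\<lambda>q. h (f q))"
  by (rule hol_at_comp_map[OF self_map fixed])

lemma fix_idealI:
  assumes "hol_at A p h" "\<And>j. hol_at A p (u j)"
    and "\<forall>\<^sub>F q in nhds p. h q = (\<Sum>j\<in>UNIV. u j q * (x q $ j - x (f q) $ j))"
  shows "h \<in> fix_ideal"
  using assms unfolding fixed_ideal_def by blast

lemma fix_idealE:
  assumes "h \<in> fix_ideal"
  obtains u where "hol_at A p h" "\<And>j. hol_at A p (u j)"
    and "\<forall>\<^sub>F q in nhds p. h q = (\<Sum>j\<in>UNIV. u j q * (x q $ j - x (f q) $ j))"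
  using assms unfolding fixed_ideal_def by blast

lemma fix_ideal_cong:
  assumes "h \<in> fix_ideal" "\<forall>\<^sub>F q in nhds p. h q = h' q"
  shows "h' \<in> fix_ideal"
proof (rule fix_idealE[OF assms(1)])
  fix u assume h: "hol_at A p h" and u: "\<And>j. hol_at A p (u j)"
    and eq: "\<forall>\<^sub>F q in nhds p. h q = (\<Sum>j\<in>UNIV. u j q * (x q $ j - x (f q) $ j))"
  show ?thesis
  proof (rule fix_idealI)
    show "hol_at A p h'" by (rule hol_at_cong[OF h assms(2)])
    show "\<forall>\<^sub>F q in nhds p. h' q = (\<Sum>j\<in>UNIV. u j q * (x q $ j - x (f q) $ j))"
      using assms(2) eq by eventually_elim simp
  qed (rule u)
qed

lemma fix_ideal_add:
  assumes "h \<in> fix_ideal" "k \<in> fix_ideal"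
  shows "(\<lambda>q. h q + k q) \<in> fix_ideal"
proof (rule fix_idealE[OF assms(1)], rule fix_idealE[OF assms(2)])
  fix u v assume h: "hol_at A p h" and u: "\<And>j. hol_at A p (u j)"
    and hu: "\<forall>\<^sub>F q in nhds p. h q = (\<Sum>j\<in>UNIV. u j q * (x q $ j - x (f q) $ j))"
    and k: "hol_at A p k" and v: "\<And>j. hol_at A p (v j)"
    and kv: "\<forall>\<^sub>F q in nhds p. k q = (\<Sum>j\<in>UNIV. v j q * (x q $ j - x (f q) $ j))"
  show ?thesis
  proof (rule fix_idealI)
    show "\<forall>\<^sub>F q in nhds p. h q + k q = (\<Sum>j\<in>UNIV. (u j q + v j q) * (x q $ j - x (f q) $ j))"
      using hu kv by eventually_elim (simp only: sum.distrib distrib_right)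
  qed (intro hol_at_add h k u v)+
qed

lemma fix_ideal_mult:
  assumes "hol_at A p h" "k \<in> fix_ideal"
  shows "(\<lambda>q. h q * k q) \<in> fix_ideal"
proof (rule fix_idealE[OF assms(2)])
  fix v assume k: "hol_at A p k" and v: "\<And>j. hol_at A p (v j)"
    and kv: "\<forall>\<^sub>F q in nhds p. k q = (\<Sum>j\<in>UNIV. v j q * (x q $ j - x (f q) $ j))"
  show ?thesis
  proof (rule fix_idealI)
    show "\<forall>\<^sub>F q in nhds p. h q * k q = (\<Sum>j\<in>UNIV. (h q * v j q) * (x q $ j - x (f q) $ j))"
      using kv by eventually_elim (simp only: sum_distrib_left mult.assoc)
  qed (intro hol_at_mult assms(1) k v)+
qed

lemma fix_ideal_zero: "(\<lambda>q. 0) \<in> fix_ideal"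
  by (rule fix_idealI[of _ "\<lambda>j q. 0"]) (simp_all add: hol_at_const)

lemma fix_ideal_sum: "(\<And>i. i \<in> I \<Longrightarrow> h i \<in> fix_ideal) \<Longrightarrow> (\<lambda>q. \<Sum>i\<in>I. h i q) \<in> fix_ideal"
  by (induction I rule: infinite_finite_induct) (simp_all add: fix_ideal_zero fix_ideal_add)

text \<open>Hadamard's lemma for \<open>h\<close> and \<open>f\<close> read in the chart. The germ
  \<open>h\<close> may come from a different chart: in the theorem it is a normal coordinate z_j,
  whereas the ideal is that of the coordinates \<open>x\<close>.\<close>

lemma diff_comp_in_fix_ideal:
  assumes h: "hol_at A p h"
  shows "(\<lambda>q. h q - h (f q)) \<in> fix_ideal"
proof -
  define G where "G i v = x (f (inv_into U x v)) $ i" for i v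
  have G: "cgerm (G i) (x p)" for i
    using hol_at_comp[OF hol_at_coord[of i]] by (simp add: hol_at_iff G_def[abs_def])
  have Gp: "(\<chi> i. G i (x p)) = x p"
    by (simp add: G_def inv_coord base fixed vec_lambda_eta)
  obtain u where u: "\<forall>j. cgerm (u j) (x p)"
    "\<forall>\<^sub>F v in nhds (x p). h (inv_into U x v) - h (inv_into U x (\<chi> i. G i v)) = (\<Sum>j\<in>UNIV. u j v * (v $ j - G j v))"
    using hadamard_difference[OF h[unfolded hol_at_iff] G Gp] by (elim exE conjE)
  from eventually_map_in[OF self_map fixed open_domain base]
  have "\<forall>\<^sub>F v in nhds (x p). f (inv_into U x v) \<in> U"
    by (simp add: eventually_coord)
  with u(2) eventually_coord_inv have "\<forall>\<^sub>F v in nhds (x p). h (inv_into U x v) - h (f (inv_into U x v)) =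
      (\<Sum>j\<in>UNIV. u j (x (inv_into U x v)) * (x (inv_into U x v) $ j - x (f (inv_into U x v)) $ j))"
    by eventually_elim (simp add: G_def vec_lambda_eta inv_coord)
  then have "\<forall>\<^sub>F q in nhds p. h q - h (f q) = (\<Sum>j\<in>UNIV. u j (x q) * (x q $ j - x (f q) $ j))"
    by (simp add: eventually_coord)
  moreover have "hol_at A p (\<lambda>q. u j (x q))" for j
  proof -
    have "\<forall>\<^sub>F v in nhds (x p). u j v = u j (x (inv_into U x v))"
      using eventually_coord_inv by eventually_elim simp
    then show ?thesis
      unfolding hol_at_iff by (rule cgerm_cong[OF u(1)[rule_format]])
  qed
  ultimately show ?thesis
    using fix_idealI[of "\<lambda>q. h q - h (f q)" "\<lambda>j q. u j (x q)"] hol_at_diff[OF h hol_at_comp[OF h]]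
    by blast
qed

section \<open>Linearity of the residue and vanishing on the ideal\<close>

definition residue :: "('a \<Rightarrow> complex) \<Rightarrow> complex" where
  "residue h = grothendieck_residue A U x p (\<lambda>q. x q - x (f q)) h"

text \<open>The presentation is chosen from the denominators alone, so it can be fixed before
  quantifying over \<open>h\<close>; linearity becomes linearity of one Taylor coefficient. The
  default value gives the zero functional, for which the same laws are trivial.\<close>

lemma residue_cases:
  obtains "residue = (\<lambda>h. 0)"
  | N c where "monomial_presentation A x p (\<lambda>q. x q - x (f q)) N c"
      "residue = (\<lambda>h. taylor_coeff U x p N (\<lambda>q. h q * det (c q)))"
proof (cases "\<exists>N c. monomial_presentation A x p (\<lambda>q. x q - x (f q)) N c")
  case True
  obtain N c where Nc: "(SOME (N, c). monomial_presentation A x p (\<lambda>q. x q - x (f q)) N c) = (N, c)"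
    by (rule prod.exhaust)
  have "\<exists>y. case y of (N, c) \<Rightarrow> monomial_presentation A x p (\<lambda>q. x q - x (f q)) N c"
    using True by simp
  from someI_ex[OF this] have "monomial_presentation A x p (\<lambda>q. x q - x (f q)) N c"
    unfolding Nc by simp
  moreover have "residue = (\<lambda>h. taylor_coeff U x p N (\<lambda>q. h q * det (c q)))"
    by (rule ext) (simp only: residue_def grothendieck_residue_def True Nc if_True prod.case)
  ultimately show ?thesis by (rule that(2))
next
  case False
  have "residue = (\<lambda>h. 0)"
    by (rule ext) (simp only: residue_def grothendieck_residue_def False if_False)
  then show ?thesis by (rule that(1))
qed

lemma hol_at_det:
  assumes "\<And>i j. hol_at A p (\<lambda>q. M q $ i $ j)"
  shows "hol_at A p (\<lambda>q. det (M q :: complex ^ 'n ^ 'n))"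
  unfolding det_def by (intro hol_at_sum hol_at_mult hol_at_const hol_at_prod assms)

lemma residue_add:
  assumes "hol_at A p h" "hol_at A p k"
  shows "residue (\<lambda>q. h q + k q) = residue h + residue k"
proof (cases rule: residue_cases)
  case (2 N c)
  then have "hol_at A p (\<lambda>q. det (c q))"
    by (intro hol_at_det) (simp add: monomial_presentation_def)
  then show ?thesis
    using assms unfolding 2 by (simp add: distrib_right taylor_coeff_add hol_at_mult)
qed simp

lemma residue_cmult:
  assumes "hol_at A p h"
  shows "residue (\<lambda>q. a * h q) = a * residue h"
proof (cases rule: residue_cases)
  case (2 N c)
  then have "hol_at A p (\<lambda>q. det (c q))"
    by (intro hol_at_det) (simp add: monomial_presentation_def)
  then show ?thesis
    using assms unfolding 2 by (simp add: mult.assoc taylor_coeff_cmult hol_at_mult)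
qed simp

lemma residue_zero: "residue (\<lambda>q. 0) = 0"
  using residue_cmult[OF hol_at_const[of 0], of 0] by simp

lemma residue_sum:
  assumes "\<And>i. i \<in> I \<Longrightarrow> hol_at A p (h i)"
  shows "residue (\<lambda>q. \<Sum>i\<in>I. h i q) = (\<Sum>i\<in>I. residue (h i))"
  using assms
  by (induction I rule: infinite_finite_induct) (simp_all add: residue_zero residue_add hol_at_sum)

lemma residue_fix_ideal:
  assumes "h \<in> fix_ideal" shows "residue h = 0"
proof (cases rule: residue_cases)
  case (2 N c)
  obtain u where "\<forall>j. hol_at A p (u j)"
    and hu: "\<forall>\<^sub>F q in nhds p. h q = (\<Sum>j\<in>UNIV. u j q * (x q $ j - x (f q) $ j))"
    using assms by (auto simp: fixed_ideal_def)
  then have u: "hol_at A p (u j)" for j by blast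
  have c: "hol_at A p (\<lambda>q. c q $ i $ j)" for i j
    using 2(1) unfolding monomial_presentation_def by blast
  have pres: "\<forall>\<^sub>F q in nhds p. \<forall>i. x q $ i ^ Suc N = (\<Sum>j\<in>UNIV. c q $ i $ j * (x q - x (f q)) $ j)"
    using 2(1) unfolding monomial_presentation_def by blast
  \<comment> \<open>The numerator matrix of Cramer's rule: \<open>c\<close> with column
    \<open>k\<close> replaced by the vector of powers x_i ^ (N+1).\<close>
  define M where "M k i j q = (if j = k then x q $ i ^ Suc N else c q $ i $ j)" for k i j q
  have M: "hol_at A p (M k i j)" for k i j
    by (cases "j = k") (simp_all add: M_def[abs_def] c hol_at_mult hol_at_power hol_at_coord)
  \<comment> \<open>The determinant is split into its Leibniz terms because different permutations
    produce the power of different coordinates; only the single terms are visibly divisible.\<close>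
  define t where "t k \<sigma> q = u k q * (of_int (sign \<sigma>) * (\<Prod>i\<in>UNIV. M k i (\<sigma> i) q))" for k \<sigma> q
  have t: "hol_at A p (t k \<sigma>)" for k \<sigma>
    unfolding t_def by (intro hol_at_mult hol_at_const hol_at_prod u M)
  have "\<forall>\<^sub>F q in nhds p. h q * det (c q) = (\<Sum>k\<in>UNIV. \<Sum>\<sigma> | \<sigma> permutes UNIV. t k \<sigma> q)"
    using hu pres
  proof eventually_elim
    case (elim q)
    have "(c q *v (x q - x (f q))) $ i = x q $ i ^ Suc N" for i
      using elim(2) by (simp add: matrix_vector_mult_def)
    then have "(x q - x (f q)) $ k * det (c q) = det (\<chi> i j. M k i j q)" for k
      using cramer_lemma[of k "c q" "x q - x (f q)"] by (simp add: M_def cong: if_cong del: power_Suc)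
    then have cramer: "(x q $ k - x (f q) $ k) * det (c q) =
        (\<Sum>\<sigma> | \<sigma> permutes UNIV. of_int (sign \<sigma>) * (\<Prod>i\<in>UNIV. M k i (\<sigma> i) q))" for k
      by (simp add: det_def)
    have "h q * det (c q) = (\<Sum>k\<in>UNIV. u k q * ((x q $ k - x (f q) $ k) * det (c q)))"
      unfolding elim(1) by (simp only: sum_distrib_right mult.assoc)
    also have "\<dots> = (\<Sum>k\<in>UNIV. \<Sum>\<sigma> | \<sigma> permutes UNIV. t k \<sigma> q)"
      unfolding cramer t_def by (simp only: sum_distrib_left)
    finally show ?case .
  qed
  from taylor_coeff_cong[OF this, of N]
  have "residue h = (\<Sum>k\<in>UNIV. \<Sum>\<sigma> | \<sigma> permutes UNIV. taylor_coeff U x p N (t k \<sigma>))"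
    unfolding 2 by (simp add: taylor_coeff_sum t hol_at_sum)
  moreover have "taylor_coeff U x p N (t k \<sigma>) = 0" if "\<sigma> permutes UNIV" for k \<sigma>
  proof -
    \<comment> \<open>The row in which \<sigma> meets the replaced column \<open>k\<close>; the
      factor from that row is the required power.\<close>
    define i0 where "i0 = inv \<sigma> k"
    have i0: "\<sigma> i0 = k"
      using that by (simp add: i0_def permutes_inverses)
    have "t k \<sigma> q = (u k q * (of_int (sign \<sigma>) * (\<Prod>i\<in>UNIV - {i0}. M k i (\<sigma> i) q))) * x q $ i0 ^ Suc N" for q
    proof -
      have "(\<Prod>i\<in>UNIV. M k i (\<sigma> i) q) = M k i0 (\<sigma> i0) q * (\<Prod>i\<in>UNIV - {i0}. M k i (\<sigma> i) q)"
        by (rule prod.remove) auto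
      moreover have "M k i0 (\<sigma> i0) q = x q $ i0 ^ Suc N"
        by (simp add: M_def i0)
      ultimately show ?thesis
        unfolding t_def by (simp only: mult_ac)
    qed
    then have "coord_div i0 (Suc N) (t k \<sigma>)"
      unfolding coord_div_def
      by (intro exI[of _ "\<lambda>q. u k q * (of_int (sign \<sigma>) * (\<Prod>i\<in>UNIV - {i0}. M k i (\<sigma> i) q))"])
        (auto intro!: hol_at_mult hol_at_const hol_at_prod u M)
    then show ?thesis
      by (rule taylor_coeff_coord_div) (simp add: centred)
  qed
  ultimately show ?thesis by simp
qed simp

text \<open>Vanishing on the ideal makes the residue constant on the coset, and the coset contains
  \<open>h\<close>; hence the description by \<open>THE\<close> is met by exactly one
  number.\<close>

lemma residue_functional_fixed_class:
  assumes h: "hol_at A p h"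
  shows "residue_functional A f p U x (fixed_class A f p x h) = residue h"
proof -
  have "residue h' = residue h" if h': "h' \<in> fixed_class A f p x h" for h'
  proof -
    have hol: "hol_at A p h'" and diff: "(\<lambda>q. h' q - h q) \<in> fix_ideal"
      using h' by (simp_all add: fixed_class_def)
    have "residue (\<lambda>q. (h' q - h q) + h q) = residue (\<lambda>q. h' q - h q) + residue h"
      by (rule residue_add[OF hol_at_diff[OF hol h] h])
    moreover have "residue (\<lambda>q. h' q - h q) = 0"
      by (rule residue_fix_ideal[OF diff])
    ultimately show ?thesis by simp
  qed
  moreover have "h \<in> fixed_class A f p x h"
    using h by (simp add: fixed_class_def fix_ideal_zero)
  ultimately have "(THE s. \<exists>h'\<in>fixed_class A f p x h. s = residue h') = residue h"
    by (intro the_equality) blast+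
  then show ?thesis
    by (simp only: residue_functional_def residue_def)
qed

end


section \<open>Determinants modulo the fixed-point ideal\<close>

text \<open>Each Leibniz term has as many linear factors as there are indices. The bound justifies
  summing coefficients only up to the dimension, as \<open>boundary_index\<close> does.\<close>

lemma degree_det_le:
  fixes M :: "complex poly ^ 'n ^ 'n"
  assumes "\<And>i j. degree (M $ i $ j) \<le> 1"
  shows "degree (det M) \<le> CARD('n)"
proof -
  have "degree (of_int (sign \<sigma>) * (\<Prod>i\<in>UNIV. M $ i $ \<sigma> i)) \<le> CARD('n)" for \<sigma> :: "'n \<Rightarrow> 'n"
  proof -
    have "degree (of_int (sign \<sigma>) * (\<Prod>i\<in>UNIV. M $ i $ \<sigma> i)) \<le>
        degree (of_int (sign \<sigma>) :: complex poly) + degree (\<Prod>i\<in>UNIV. M $ i $ \<sigma> i)"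
      by (rule degree_mult_le)
    also have "\<dots> = degree (\<Prod>i\<in>UNIV. M $ i $ \<sigma> i)"
      by simp
    also have "\<dots> \<le> sum (degree \<circ> (\<lambda>i. M $ i $ \<sigma> i)) UNIV"
      by (rule degree_prod_sum_le) simp
    also have "\<dots> \<le> (\<Sum>i\<in>(UNIV :: 'n set). 1)"
      by (rule sum_mono) (simp add: assms[unfolded One_nat_def])
    finally show ?thesis by simp
  qed
  then show ?thesis
    unfolding det_def by (intro degree_sum_le) auto
qed

text \<open>Transposition turns the columns into rows, where \<open>det_rows_mul\<close>
  applies.\<close>

lemma det_scale_columns:
  fixes M :: "'b::comm_ring_1 ^ 'n ^ 'n"
  shows "det (\<chi> i j. c j * M $ i $ j) = (\<Prod>j\<in>UNIV. c j) * det M"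
proof -
  have "det (\<chi> i j. c j * M $ i $ j) = det (transpose (\<chi> i j. c j * M $ i $ j))"
    by (rule det_transpose[symmetric])
  also have "transpose (\<chi> i j. c j * M $ i $ j) = (\<chi> j. c j *s transpose M $ j)"
    by (simp add: transpose_def vec_eq_iff)
  also have "det \<dots> = (\<Prod>j\<in>UNIV. c j) * det (\<chi> j. transpose M $ j)"
    by (rule det_rows_mul)
  also have "(\<chi> j. transpose M $ j) = transpose M"
    by (simp add: vec_eq_iff)
  finally show ?thesis by (simp only: det_transpose)
qed

section \<open>Polynomials in y over the germs, modulo the fixed-point ideal\<close>

context fixed_point_chart
begin

definition poly_hol :: "('a \<Rightarrow> complex poly) \<Rightarrow> bool" where
  "poly_hol P \<longleftrightarrow> (\<forall>d. hol_at A p (\<lambda>q. coeff (P q) d))"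

text \<open>Equality in A_{f,p}[y], expressed by representatives and coefficient by
  coefficient.\<close>

definition poly_cong :: "('a \<Rightarrow> complex poly) \<Rightarrow> ('a \<Rightarrow> complex poly) \<Rightarrow> bool" where
  "poly_cong P Q \<longleftrightarrow> (\<forall>d. (\<lambda>q. coeff (P q) d - coeff (Q q) d) \<in> fix_ideal)"

lemma poly_hol_const: "poly_hol (\<lambda>q. P)"
  by (simp add: poly_hol_def hol_at_const)

lemma poly_hol_monom: "hol_at A p h \<Longrightarrow> poly_hol (\<lambda>q. monom (h q) m)"
  unfolding poly_hol_def coeff_monom
proof
  fix d assume "hol_at A p h"
  then show "hol_at A p (\<lambda>q. if m = d then h q else 0)"
    by (cases "m = d") (simp_all add: hol_at_const)
qed

lemma poly_hol_add: "poly_hol P \<Longrightarrow> poly_hol Q \<Longrightarrow> poly_hol (\<lambda>q. P q + Q q)"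
  unfolding poly_hol_def coeff_add using hol_at_add by blast

lemma poly_hol_mult:
  assumes "poly_hol P" "poly_hol Q" shows "poly_hol (\<lambda>q. P q * Q q)"
  unfolding poly_hol_def coeff_mult
proof
  fix d
  show "hol_at A p (\<lambda>q. \<Sum>i\<le>d. coeff (P q) i * coeff (Q q) (d - i))"
    using assms unfolding poly_hol_def by (intro hol_at_sum hol_at_mult) blast+
qed

lemma poly_hol_sum: "(\<And>i. i \<in> I \<Longrightarrow> poly_hol (P i)) \<Longrightarrow> poly_hol (\<lambda>q. \<Sum>i\<in>I. P i q)"
  by (induction I rule: infinite_finite_induct) (simp_all add: poly_hol_const poly_hol_add)

lemma poly_hol_prod: "(\<And>i. i \<in> I \<Longrightarrow> poly_hol (P i)) \<Longrightarrow> poly_hol (\<lambda>q. \<Prod>i\<in>I. P i q)"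
  by (induction I rule: infinite_finite_induct) (simp_all add: poly_hol_const poly_hol_mult)

lemma poly_hol_det:
  fixes M :: "'k::finite \<Rightarrow> 'k \<Rightarrow> 'a \<Rightarrow> complex poly"
  assumes "\<And>i j. poly_hol (M i j)"
  shows "poly_hol (\<lambda>q. det (\<chi> i j . M i j q))"
  unfolding det_def vec_lambda_beta by (intro poly_hol_sum poly_hol_mult poly_hol_const poly_hol_prod assms)

lemma poly_cong_refl: "poly_cong P P"
  by (simp add: poly_cong_def fix_ideal_zero)

lemma poly_cong_add:
  assumes "poly_cong P P'" "poly_cong Q Q'"
  shows "poly_cong (\<lambda>q. P q + Q q) (\<lambda>q. P' q + Q' q)"
  unfolding poly_cong_def
proof
  fix d
  have "(\<lambda>q. (coeff (P q) d - coeff (P' q) d) + (coeff (Q q) d - coeff (Q' q) d)) \<in> fix_ideal"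
    using assms unfolding poly_cong_def by (intro fix_ideal_add) blast+
  then show "(\<lambda>q. coeff (P q + Q q) d - coeff (P' q + Q' q) d) \<in> fix_ideal"
    by (simp add: algebra_simps)
qed

text \<open>Uses P Q - P' Q' = P (Q - Q') + Q' (P - P'); the multipliers are P and Q', which is why
  holomorphy is asked of exactly these two.\<close>

lemma poly_cong_mult:
  assumes P: "poly_cong P P'" and Q: "poly_cong Q Q'" and hol: "poly_hol P" "poly_hol Q'"
  shows "poly_cong (\<lambda>q. P q * Q q) (\<lambda>q. P' q * Q' q)"
  unfolding poly_cong_def
proof
  fix d
  have "(\<lambda>q. (\<Sum>i\<le>d. coeff (P q) i * (coeff (Q q) (d - i) - coeff (Q' q) (d - i))) +
      (\<Sum>i\<le>d. coeff (Q' q) (d - i) * (coeff (P q) i - coeff (P' q) i))) \<in> fix_ideal"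
  proof (intro fix_ideal_add fix_ideal_sum)
    fix i
    show "(\<lambda>q. coeff (P q) i * (coeff (Q q) (d - i) - coeff (Q' q) (d - i))) \<in> fix_ideal"
      by (rule fix_ideal_mult) (use Q hol in \<open>simp_all add: poly_cong_def poly_hol_def\<close>)
    show "(\<lambda>q. coeff (Q' q) (d - i) * (coeff (P q) i - coeff (P' q) i)) \<in> fix_ideal"
      by (rule fix_ideal_mult) (use P hol in \<open>simp_all add: poly_cong_def poly_hol_def\<close>)
  qed
  moreover have "(\<Sum>i\<le>d. coeff (P q) i * (coeff (Q q) (d - i) - coeff (Q' q) (d - i))) +
      (\<Sum>i\<le>d. coeff (Q' q) (d - i) * (coeff (P q) i - coeff (P' q) i)) =
      coeff (P q * Q q) d - coeff (P' q * Q' q) d" for q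
    unfolding coeff_mult sum.distrib[symmetric] sum_subtractf[symmetric]
    by (intro sum.cong refl) (simp add: algebra_simps)
  ultimately show "(\<lambda>q. coeff (P q * Q q) d - coeff (P' q * Q' q) d) \<in> fix_ideal"
    by simp
qed

lemma poly_cong_sum:
  assumes "\<And>i. i \<in> I \<Longrightarrow> poly_cong (P i) (Q i)"
  shows "poly_cong (\<lambda>q. \<Sum>i\<in>I. P i q) (\<lambda>q. \<Sum>i\<in>I. Q i q)"
  using assms
  by (induction I rule: infinite_finite_induct) (simp_all add: poly_cong_refl poly_cong_add)

lemma poly_cong_prod:
  assumes "\<And>i. i \<in> I \<Longrightarrow> poly_cong (P i) (Q i)"
    and "\<And>i. i \<in> I \<Longrightarrow> poly_hol (P i)" "\<And>i. i \<in> I \<Longrightarrow> poly_hol (Q i)"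
  shows "poly_cong (\<lambda>q. \<Prod>i\<in>I. P i q) (\<lambda>q. \<Prod>i\<in>I. Q i q)"
  using assms
proof (induction I rule: infinite_finite_induct)
  case (insert a I)
  have "poly_cong (\<lambda>q. P a q * (\<Prod>i\<in>I. P i q)) (\<lambda>q. Q a q * (\<Prod>i\<in>I. Q i q))"
    using insert.prems by (intro poly_cong_mult poly_hol_prod insert.IH) blast+
  with insert.hyps show ?case by simp
qed (simp_all add: poly_cong_refl)

lemma poly_cong_det:
  fixes M :: "'k::finite \<Rightarrow> 'k \<Rightarrow> 'a \<Rightarrow> complex poly"
  assumes "\<And>i j. poly_cong (M i j) (N i j)" "\<And>i j. poly_hol (M i j)" "\<And>i j. poly_hol (N i j)"
  shows "poly_cong (\<lambda>q. det (\<chi> i j . M i j q)) (\<lambda>q. det (\<chi> i j . N i j q))"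
  unfolding det_def vec_lambda_beta
  by (intro poly_cong_sum poly_cong_mult poly_cong_refl poly_cong_prod poly_hol_prod poly_hol_const assms)

text \<open>\<open>B\<close> does not depend on the point, so the coefficientwise residue, being
  linear, commutes with multiplication by \<open>B\<close>. The degree bounds ensure that cutting
  off at \<open>n\<close> loses no coefficient.\<close>

lemma residue_poly_dvd:
  assumes \<tau>: "hol_at A p \<tau>" and P: "poly_cong P (\<lambda>q. B * Q q)" and Q: "poly_hol Q"
    and deg: "\<And>q. degree (B * Q q) \<le> n" "\<And>q. degree (Q q) \<le> n"
  shows "B dvd (\<Sum>d\<le>n. monom (residue (\<lambda>q. \<tau> q * coeff (P q) d)) d)"
proof -
  \<comment> \<open>The quotient: the residue polynomial formed with \<open>Q\<close> in place of
    \<open>P\<close>.\<close>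
  define R where "R = (\<Sum>d\<le>n. monom (residue (\<lambda>q. \<tau> q * coeff (Q q) d)) d)"
  have holQ: "hol_at A p (\<lambda>q. \<tau> q * coeff (Q q) d)" for d
    using Q by (intro hol_at_mult \<tau>) (simp add: poly_hol_def)
  \<comment> \<open>Wanted for all \<open>d\<close>, beyond \<open>n\<close> as well, so that the
    convolution formula for the coefficients of \<open>B * R\<close> can be used without case
    distinctions.\<close>
  have coeffR: "coeff R d = residue (\<lambda>q. \<tau> q * coeff (Q q) d)" for d
  proof (cases "d \<le> n")
    case False
    then have "coeff (Q q) d = 0" for q
      using deg(2)[of q] by (intro coeff_eq_0) linarith
    with False show ?thesis
      by (simp add: R_def coeff_sum residue_zero)
  qed (simp add: R_def coeff_sum)
  have BQ: "(\<lambda>q. \<tau> q * coeff (B * Q q) d) = (\<lambda>q. \<Sum>i\<le>d. coeff B i * (\<tau> q * coeff (Q q) (d - i)))" for d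
    by (simp add: coeff_mult sum_distrib_left mult.left_commute)
  have holBQ: "hol_at A p (\<lambda>q. \<tau> q * coeff (B * Q q) d)" for d
    unfolding BQ by (intro hol_at_sum hol_at_mult[OF hol_at_const] holQ)
  have resBQ: "residue (\<lambda>q. \<tau> q * coeff (B * Q q) d) = coeff (B * R) d" for d
  proof -
    have "residue (\<lambda>q. \<tau> q * coeff (B * Q q) d) = (\<Sum>i\<le>d. residue (\<lambda>q. coeff B i * (\<tau> q * coeff (Q q) (d - i))))"
      unfolding BQ by (rule residue_sum) (rule hol_at_mult[OF hol_at_const holQ])
    also have "\<dots> = coeff (B * R) d"
      unfolding residue_cmult[OF holQ] coeffR[symmetric] coeff_mult ..
    finally show ?thesis .
  qed
  have resP: "residue (\<lambda>q. \<tau> q * coeff (P q) d) = coeff (B * R) d" for d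
  proof -
    have diff: "(\<lambda>q. \<tau> q * (coeff (P q) d - coeff (B * Q q) d)) \<in> fix_ideal"
      using P by (intro fix_ideal_mult \<tau>) (simp add: poly_cong_def)
    then have hol_diff: "hol_at A p (\<lambda>q. \<tau> q * (coeff (P q) d - coeff (B * Q q) d))"
      by (simp add: fixed_ideal_def)
    have "residue (\<lambda>q. \<tau> q * (coeff (P q) d - coeff (B * Q q) d) + \<tau> q * coeff (B * Q q) d) =
        residue (\<lambda>q. \<tau> q * (coeff (P q) d - coeff (B * Q q) d)) + residue (\<lambda>q. \<tau> q * coeff (B * Q q) d)"
      by (rule residue_add[OF hol_diff holBQ])
    then show ?thesis
      unfolding residue_fix_ideal[OF diff] resBQ by (simp add: right_diff_distrib)
  qed
  have "coeff (\<Sum>d\<le>n. monom (residue (\<lambda>q. \<tau> q * coeff (P q) d)) d) d = coeff (B * R) d" for d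
  proof (cases "d \<le> n")
    case False
    then have "coeff (B * Q q) d = 0" for q
      using deg(1)[of q] by (intro coeff_eq_0) linarith
    then have "coeff (B * R) d = 0"
      using resBQ[of d] by (simp add: residue_zero)
    with False show ?thesis
      by (simp add: coeff_sum)
  qed (simp add: coeff_sum resP)
  then have "(\<Sum>d\<le>n. monom (residue (\<lambda>q. \<tau> q * coeff (P q) d)) d) = B * R"
    by (rule poly_eqI)
  then show ?thesis by simp
qed

lemma poly_hol_det_one_plus:
  assumes "\<And>i j. hol_at A p (\<lambda>q. J q $ i $ j)"
  shows "poly_hol (\<lambda>q. det_one_plus (J q))"
proof -
  have "det_one_plus (J q) = det (\<chi> i j. (if i = j then 1 else 0) + monom (J q $ i $ j) 1)" for q
    by (simp add: det_one_plus_def mat_def plus_vec_def)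
  then show ?thesis
    by (simp only:) (intro poly_hol_det poly_hol_add poly_hol_const poly_hol_monom assms)
qed

lemma residue_det_one_plus_dvd:
  fixes J :: "'a \<Rightarrow> complex ^ 'm ^ 'm"
  assumes \<tau>: "hol_at A p \<tau>" and J: "\<And>i j. hol_at A p (\<lambda>q. J q $ i $ j)"
    and S: "\<And>i j. j \<in> S \<Longrightarrow> (\<lambda>q. J q $ i $ j - (if i = j then 1 else 0)) \<in> fix_ideal"
  shows "[:1, 1:] ^ card S dvd
    (\<Sum>d\<le>CARD('m). monom (residue (\<lambda>q. \<tau> q * coeff (det_one_plus (J q)) d)) d)"
proof -
  define M where "M i j q = (if i = j then 1 else 0) + monom (J q $ i $ j) 1" for i j q
  \<comment> \<open>The columns in \<open>S\<close> become unit vectors; the factor 1 + y that they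
    carry modulo the ideal is kept separately in \<open>c\<close>.\<close>
  define N :: "'m \<Rightarrow> 'm \<Rightarrow> 'a \<Rightarrow> complex poly"
    where "N i j q = (if j \<in> S then if i = j then 1 else 0 else M i j q)" for i j q
  define c :: "'m \<Rightarrow> complex poly" where "c j = (if j \<in> S then [:1, 1:] else 1)" for j
  define Q where "Q q = det (\<chi> i j. N i j q)" for q
  have det_M: "det_one_plus (J q) = det (\<chi> i j. M i j q)" for q
    by (simp add: det_one_plus_def M_def mat_def plus_vec_def)
  have prod_c: "(\<Prod>j\<in>UNIV. c j) = [:1, 1:] ^ card S"
    by (simp add: c_def prod.If_cases)
  have det_N: "det (\<chi> i j. c j * N i j q) = [:1, 1:] ^ card S * Q q" for q
    using det_scale_columns[of c "\<chi> i j. N i j q"] by (simp add: prod_c Q_def)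
  have M_hol: "poly_hol (M i j)" for i j
    unfolding M_def by (intro poly_hol_add poly_hol_const poly_hol_monom J)
  have N_hol: "poly_hol (N i j)" for i j
    using M_hol[of i j] poly_hol_const by (cases "j \<in> S") (simp_all add: N_def[abs_def])
  have cN_hol: "poly_hol (\<lambda>q. c j * N i j q)" for i j
    by (intro poly_hol_mult poly_hol_const N_hol)
  have MN: "poly_cong (M i j) (\<lambda>q. c j * N i j q)" for i j
  proof (cases "j \<in> S")
    case True
    \<comment> \<open>In a column from \<open>S\<close> the constant terms cancel, and the only
      surviving coefficient, that of y, is the entry of J - 1 assumed to lie in the ideal.\<close>
    have eq: "coeff (M i j q) d - coeff (c j * N i j q) d =
        (if d = 1 then J q $ i $ j - (if i = j then 1 else 0) else 0)" for q d
      using True by (simp add: M_def N_def c_def coeff_pCons split: nat.split)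
    show ?thesis
    proof -
      have "(\<lambda>q. if d = 1 then J q $ i $ j - (if i = j then 1 else 0) else 0) \<in> fix_ideal" for d :: nat
        using S[OF True, of i] fix_ideal_zero by (cases "d = 1") (simp_all only: if_True if_False simp_thms)
      with eq show ?thesis
        unfolding poly_cong_def by (simp only: simp_thms)
    qed
  next
    case False
    then have "(\<lambda>q. c j * N i j q) = M i j" by (simp add: c_def N_def)
    then show ?thesis by (simp only: poly_cong_refl)
  qed
  have "poly_cong (\<lambda>q. det (\<chi> i j. M i j q)) (\<lambda>q. det (\<chi> i j. c j * N i j q))"
    by (rule poly_cong_det) (rule MN M_hol cN_hol)+
  then have "poly_cong (\<lambda>q. det_one_plus (J q)) (\<lambda>q. [:1, 1:] ^ card S * Q q)"
    by (simp only: det_M det_N)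
  moreover have "poly_hol Q"
    unfolding Q_def[abs_def] by (rule poly_hol_det[OF N_hol])
  \<comment> \<open>The bound stays at the dimension because the linear factors \<open>c j\<close>
    multiply only columns whose entries in \<open>N\<close> are constant.\<close>
  moreover have "degree ([:1, 1:] ^ card S * Q q) \<le> CARD('m)" "degree (Q q) \<le> CARD('m)" for q
  proof -
    have M: "degree (M i j q) \<le> 1" for i j
    proof -
      have "degree (M i j q) \<le> max (degree (if i = j then 1 else 0 :: complex poly)) (degree (monom (J q $ i $ j) 1))"
        unfolding M_def by (rule degree_add_le_max)
      also have "\<dots> \<le> 1"
        by (auto intro: order_trans[OF degree_monom_le])
      finally show ?thesis .
    qed
    then have N: "degree (N i j q) \<le> 1" for i j
      by (simp add: N_def)
    have "degree (c j * N i j q) \<le> 1" for i j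
    proof -
      have "c j * N i j q = (if j \<in> S then if i = j then [:1, 1:] else 0 else M i j q)"
        unfolding c_def N_def by (simp only: mult_1_left mult_1_right mult_zero_right split: if_split) blast
      with M[of i j] show ?thesis by simp
    qed
    then show "degree ([:1, 1:] ^ card S * Q q) \<le> CARD('m)"
      unfolding det_N[symmetric] by (intro degree_det_le) simp
    show "degree (Q q) \<le> CARD('m)"
      unfolding Q_def using N by (intro degree_det_le) simp
  qed
  ultimately show ?thesis
    by (intro residue_poly_dvd[OF \<tau>])
qed

end


section \<open>Trace and logarithmic Jacobian\<close>

text \<open>The logarithmic frame is diagonal with respect to the coordinate differentials, so each
  component isolates one coefficient; off the divisor its factor is nonzero and the coefficient can
  be recovered.\<close>

lemma log_frame_expansion_nth:
  fixes K :: "complex ^ 'n::finite"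
  shows "(\<Sum>j\<in>UNIV. K $ j *s log_frame z S j q) $ l = K $ l * (if l \<in> S then 1 / z q $ l else 1)"
proof -
  have "(\<Sum>j\<in>UNIV. K $ j *s log_frame z S j q) $ l =
      (\<Sum>j\<in>UNIV. if j = l then K $ l * (if l \<in> S then 1 / z q $ l else 1) else 0)"
    unfolding sum_component by (rule sum.cong) (auto simp: log_frame_def axis_def)
  then show ?thesis by (simp only: sum.delta finite UNIV_I if_True)
qed

lemma form_pullback_log_frame_nth:
  "form_pullback U z f (log_frame z S i) q $ l =
    (if i \<in> S then 1 / z (f q) $ i else 1) * coord_deriv U z l (\<lambda>y. z (f y) $ i) q"
proof -
  have "form_pullback U z f (log_frame z S i) q $ l = (\<Sum>j\<in>UNIV. if j = i
      then (if i \<in> S then 1 / z (f q) $ i else 1) * coord_deriv U z l (\<lambda>y. z (f y) $ i) q else 0)"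
    unfolding form_pullback_def vec_lambda_beta by (rule sum.cong) (auto simp: log_frame_def axis_def)
  then show ?thesis by (simp only: sum.delta finite UNIV_I if_True)
qed

lemma hol_on_imp_hol_at: "hol_on A W h \<Longrightarrow> p \<in> W \<Longrightarrow> hol_at A p h"
  unfolding hol_at_def by blast

lemma frame_section_coords:
  assumes "local_frame A r pr T W \<psi>" "y \<in> W" "i < r"
  shows "pr (frame_section r pr \<psi> i y) = y"
    and "l < r \<Longrightarrow> \<psi> (frame_section r pr \<psi> i y) l = (if l = i then 1 else 0)"
proof -
  let ?w = "\<lambda>j\<in>{..<r}. if j = i then 1 else 0 :: complex"
  have "bij_betw \<psi> (pr -` {y}) ({..<r} \<rightarrow>\<^sub>E UNIV)"
    using assms(1,2) by (simp add: local_frame_def)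
  then have w: "?w \<in> \<psi> ` (pr -` {y})"
    by (auto simp: bij_betw_def)
  show "pr (frame_section r pr \<psi> i y) = y"
    using inv_into_into[OF w] by (simp add: frame_section_def)
  show "\<psi> (frame_section r pr \<psi> i y) l = (if l = i then 1 else 0)" if "l < r"
    using f_inv_into_f[OF w] that by (simp add: frame_section_def)
qed

section \<open>Holomorphy of the trace\<close>

context fixed_point_chart
begin

text \<open>\<open>linearisation\<close> gives holomorphic matrices only for members of
  \<open>T\<close>, while \<psi> is any local frame. Near \<open>p\<close> the matrix in the frame
  \<psi> is the product of \<open>H\<close>, \<open>M\<close> and the pull-back of \<open>G\<close>,
  with one trivialisation \<theta> used at both q and f q since \<open>f p = p\<close>.\<close>

lemma hol_at_frame_trace:
  assumes vb: "holo_vector_bundle A r pr T" and lin: "linearisation A r pr T f \<Phi>"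
    and frame: "local_frame A r pr T W \<psi>" and pW: "p \<in> W"
  shows "hol_at A p (frame_trace r pr \<psi> f \<Phi>)"
proof -
  have "p \<in> (\<Union>(W, \<psi>)\<in>T. W)"
    using vb by (simp add: holo_vector_bundle_def)
  then obtain V \<theta> where V: "(V, \<theta>) \<in> T" "p \<in> V" by blast
  have openW: "open W" "open V"
    using frame vb V(1) by (auto simp: local_frame_def holo_vector_bundle_def)
  have trans: "linear_transition A r pr W \<psi> V \<theta>" "linear_transition A r pr V \<theta> W \<psi>"
    using frame V(1) by (auto simp: local_frame_def)
  obtain G where G: "\<forall>i<r. \<forall>j<r. hol_on A (W \<inter> V) (G i j)"
    "\<forall>e. pr e \<in> W \<inter> V \<longrightarrow> (\<forall>i<r. \<theta> e i = (\<Sum>j<r. G i j (pr e) * \<psi> e j))"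
    using trans(1) unfolding linear_transition_def by (elim exE conjE)
  obtain H where H: "\<forall>i<r. \<forall>j<r. hol_on A (V \<inter> W) (H i j)"
    "\<forall>e. pr e \<in> V \<inter> W \<longrightarrow> (\<forall>i<r. \<psi> e i = (\<Sum>j<r. H i j (pr e) * \<theta> e j))"
    using trans(2) unfolding linear_transition_def by (elim exE conjE)
  have over: "pr (\<Phi> y e) = y" if "pr e = f y" for y e
    using lin that by (simp add: linearisation_def)
  have "\<exists>M. (\<forall>i<r. \<forall>j<r. hol_on A (V \<inter> f -` V) (M i j)) \<and>
      (\<forall>y \<in> V \<inter> f -` V. \<forall>e. pr e = f y \<longrightarrow> (\<forall>i<r. \<theta> (\<Phi> y e) i = (\<Sum>j<r. M i j y * \<theta> e j)))"
    using lin V(1) unfolding linearisation_def by fast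
  then obtain M where M: "\<forall>i<r. \<forall>j<r. hol_on A (V \<inter> f -` V) (M i j)"
    "\<forall>y \<in> V \<inter> f -` V. \<forall>e. pr e = f y \<longrightarrow> (\<forall>i<r. \<theta> (\<Phi> y e) i = (\<Sum>j<r. M i j y * \<theta> e j))"
    by (elim exE conjE)
  \<comment> \<open>The trace of that product, written out; \<open>G\<close> is evaluated at f q
    because it changes frames in the source fibre.\<close>
  have "hol_at A p (\<lambda>q. \<Sum>i<r. \<Sum>j<r. H i j q * (\<Sum>k<r. M j k q * G k i (f q)))"
  proof (intro hol_at_sum)
    fix i j assume ij: "i \<in> {..<r}" "j \<in> {..<r}"
    have "hol_at A p (\<lambda>q. \<Sum>k<r. M j k q * G k i (f q))"
    proof (rule hol_at_sum)
      fix k assume k: "k \<in> {..<r}"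
      have "hol_at A p (M j k)" "hol_at A p (G k i)"
        using M(1) G(1) ij k V pW fixed by (auto intro!: hol_on_imp_hol_at)
      then show "hol_at A p (\<lambda>q. M j k q * G k i (f q))"
        by (intro hol_at_mult hol_at_comp)
    qed
    moreover have "hol_at A p (H i j)"
      using H(1) ij V pW by (auto intro!: hol_on_imp_hol_at)
    ultimately show "hol_at A p (\<lambda>q. H i j q * (\<Sum>k<r. M j k q * G k i (f q)))"
      by (rule hol_at_mult[rotated])
  qed
  moreover have "\<forall>\<^sub>F q in nhds p. (\<Sum>i<r. \<Sum>j<r. H i j q * (\<Sum>k<r. M j k q * G k i (f q))) = frame_trace r pr \<psi> f \<Phi> q"
  proof -
    have "open (W \<inter> V)" "p \<in> W \<inter> V" using openW V pW by auto
    from eventually_nhds_in_open[OF this] eventually_map_in[OF self_map fixed this]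
    show ?thesis
    proof eventually_elim
      case (elim q)
      have "(\<Sum>j<r. H i j q * (\<Sum>k<r. M j k q * G k i (f q))) = \<psi> (\<Phi> q (frame_section r pr \<psi> i (f q))) i"
        if i: "i < r" for i
      proof -
        define e where "e = frame_section r pr \<psi> i (f q)"
        have e: "pr e = f q" "\<And>l. l < r \<Longrightarrow> \<psi> e l = (if l = i then 1 else 0)"
          using frame_section_coords[OF frame _ i] elim(2) by (auto simp: e_def)
        have "\<psi> (\<Phi> q e) i = (\<Sum>j<r. H i j q * \<theta> (\<Phi> q e) j)"
          using H(2) over[OF e(1)] elim(1) i by auto
        also have "\<dots> = (\<Sum>j<r. H i j q * (\<Sum>k<r. M j k q * \<theta> e k))"
          using M(2) e(1) elim by (intro sum.cong refl) auto
        also have "\<dots> = (\<Sum>j<r. H i j q * (\<Sum>k<r. M j k q * G k i (f q)))"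
        proof (intro sum.cong refl arg_cong2[where f = "(*)"])
          fix k assume "k \<in> {..<r}"
          then have "\<theta> e k = (\<Sum>l<r. G k l (f q) * \<psi> e l)"
            using G(2) e(1) elim(2) by auto
          also have "\<dots> = (\<Sum>l<r. if l = i then G k l (f q) else 0)"
            by (intro sum.cong refl) (simp add: e(2))
          also have "\<dots> = G k i (f q)"
            using i by simp
          finally show "\<theta> e k = G k i (f q)" .
        qed
        finally show ?thesis by (simp add: e_def)
      qed
      then show ?case
        by (simp add: frame_trace_def)
    qed
  qed
  ultimately show ?thesis by (rule hol_at_cong)
qed

end

section \<open>Density of the complement of the divisor\<close>

context chart_at
begin

text \<open>Continuity near \<open>p\<close> together with density of the complement of the
  hyperplanes; the limit is taken at every nearby \<open>q\<close>, so the conclusion is about the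
  germ and not just the value at \<open>p\<close>.\<close>

lemma hol_at_zero_off_coord_hyperplanes:
  assumes h: "hol_at A p h" and zero: "\<forall>\<^sub>F q in nhds p. (\<forall>j\<in>S. x q $ j \<noteq> 0) \<longrightarrow> h q = 0"
  shows "\<forall>\<^sub>F q in nhds p. h q = 0"
proof -
  have "\<forall>\<^sub>F q in nhds p. \<forall>\<^sub>F y in nhds q. (\<forall>j\<in>S. x y $ j \<noteq> 0) \<longrightarrow> h y = 0"
    using zero by (simp add: eventually_eventually)
  then show ?thesis
    using hol_at_eventually[OF h] chart_at_eventually
  proof eventually_elim
    case (elim q)
    interpret q: chart_at A U x q by (rule elim(3))
    let ?\<gamma> = "\<lambda>t. \<chi> j. x q $ j + t"
    \<comment> \<open>The points \<open>x q + t (1, ..., 1)\<close> with small \<open>t \<noteq> 0\<close> avoid all the hyperplanes and tend to \<open>x q\<close>.\<close>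
    have "isCont ?\<gamma> 0"
      by (rule isCont_vec_lambda) simp
    then have \<gamma>: "filterlim ?\<gamma> (nhds (x q)) (at 0)"
      by (simp add: isCont_def vec_lambda_eta)
    have "\<forall>\<^sub>F v in nhds (x q). (\<forall>j\<in>S. x (inv_into U x v) $ j \<noteq> 0) \<longrightarrow> h (inv_into U x v) = 0"
      using elim(1) by (simp add: q.eventually_coord)
    with q.eventually_coord_inv have "\<forall>\<^sub>F v in nhds (x q). (\<forall>j\<in>S. v $ j \<noteq> 0) \<longrightarrow> h (inv_into U x v) = 0"
      by eventually_elim simp
    from eventually_compose_filterlim[OF this \<gamma>]
    have "\<forall>\<^sub>F t in at 0. (\<forall>j\<in>S. x q $ j + t \<noteq> 0) \<longrightarrow> h (inv_into U x (?\<gamma> t)) = 0"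
      by simp
    moreover have "\<forall>\<^sub>F t in at 0. \<forall>j. x q $ j + t \<noteq> 0"
    proof (rule eventually_all_finite)
      fix j
      have "\<forall>\<^sub>F t in at 0. t \<noteq> - (x q $ j)"
        by (rule eventually_neq_at_within)
      then show "\<forall>\<^sub>F t in at 0. x q $ j + t \<noteq> 0"
        by eventually_elim (simp add: add_eq_0_iff)
    qed
    ultimately have "\<forall>\<^sub>F t in at 0. h (inv_into U x (?\<gamma> t)) = 0"
      by eventually_elim blast
    then have "((\<lambda>t. h (inv_into U x (?\<gamma> t))) \<longlongrightarrow> 0) (at 0)"
      by (rule tendsto_eventually)
    moreover have "((\<lambda>t. h (inv_into U x (?\<gamma> t))) \<longlongrightarrow> h q) (at 0)"
    proof -
      have "isCont (\<lambda>v. h (inv_into U x v)) (x q)"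
        using elim(2) unfolding q.hol_at_iff by (intro cdiff_imp_isCont cgerm_imp_cdiff)
      then have "((\<lambda>v. h (inv_into U x v)) \<longlongrightarrow> h q) (nhds (x q))"
        using tendsto_at_iff_tendsto_nhds[of "\<lambda>v. h (inv_into U x v)" "x q"]
        by (simp add: isCont_def q.inv_coord q.base)
      from filterlim_compose[OF this \<gamma>] show ?thesis .
    qed
    ultimately show "h q = 0"
      by (rule LIM_unique[rotated])
  qed
qed

text \<open>Makes the \<open>SOME\<close> in \<open>log_jacobian\<close> harmless: the entries of
  any explicit logarithmic Jacobian are those of the chosen one, as germs.\<close>

lemma is_log_jacobian_unique:
  assumes J: "is_log_jacobian A f p U x S J" and J': "is_log_jacobian A f p U x S J'"
  shows "\<forall>\<^sub>F q in nhds p. J q $ i $ j = J' q $ i $ j"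
proof -
  have hol: "hol_at A p (\<lambda>q. J q $ i $ j - J' q $ i $ j)"
    using J J' unfolding is_log_jacobian_def by (intro hol_at_diff) blast+
  have "\<forall>\<^sub>F q in nhds p. (\<forall>j\<in>S. x q $ j \<noteq> 0) \<longrightarrow>
      (\<forall>i. form_pullback U x f (log_frame x S i) q = (\<Sum>j\<in>UNIV. J q $ i $ j *s log_frame x S j q))"
    "\<forall>\<^sub>F q in nhds p. (\<forall>j\<in>S. x q $ j \<noteq> 0) \<longrightarrow>
      (\<forall>i. form_pullback U x f (log_frame x S i) q = (\<Sum>j\<in>UNIV. J' q $ i $ j *s log_frame x S j q))"
    using J J' unfolding is_log_jacobian_def by blast+
  then have "\<forall>\<^sub>F q in nhds p. (\<forall>j\<in>S. x q $ j \<noteq> 0) \<longrightarrow> J q $ i $ j - J' q $ i $ j = 0"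
  proof eventually_elim
    case (elim q)
    show ?case
    proof
      assume nz: "\<forall>j\<in>S. x q $ j \<noteq> 0"
      have "(\<Sum>j\<in>UNIV. J q $ i $ j *s log_frame x S j q) = (\<Sum>j\<in>UNIV. J' q $ i $ j *s log_frame x S j q)"
        using elim[rule_format] nz by simp
      then have "(\<Sum>j\<in>UNIV. J q $ i $ j *s log_frame x S j q) $ j = (\<Sum>j\<in>UNIV. J' q $ i $ j *s log_frame x S j q) $ j"
        by (rule arg_cong)
      then show "J q $ i $ j - J' q $ i $ j = 0"
        unfolding log_frame_expansion_nth using nz by (auto split: if_splits)
    qed
  qed
  from hol_at_zero_off_coord_hyperplanes[OF hol this] show ?thesis
    by eventually_elim simp
qed

end

section \<open>The logarithmic Jacobian in adapted coordinates\<close>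

context fixed_point_chart
begin

text \<open>The pull-back of dx_i/x_i is dx_i/x_i + da_i/a_i for \<open>i\<close> in
  \<open>S\<close>, and for other \<open>i\<close> the pull-back of dx_i is an ordinary holomorphic
  form. Rewriting a term g dx_j as (g x_j) dx_j/x_j puts the factor x_j into each column
  \<open>j\<close> from \<open>S\<close>.\<close>

lemma log_jacobian_near_identity:
  assumes a: "\<And>i. i \<in> S \<Longrightarrow> hol_at A p (a i)" "\<And>i. i \<in> S \<Longrightarrow> a i p \<noteq> 0"
    and fa: "\<And>i. i \<in> S \<Longrightarrow> \<forall>\<^sub>F q in nhds p. x (f q) $ i = x q $ i * a i q"
  shows "is_log_jacobian A f p U x S (log_jacobian A f p U x S)"
    and "j \<in> S \<Longrightarrow> \<exists>b. hol_at A p b \<and>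
      (\<forall>\<^sub>F q in nhds p. log_jacobian A f p U x S q $ i $ j - (if i = j then 1 else 0) = b q * x q $ j)"
proof -
  \<comment> \<open>The ordinary dx_j coefficients: of da_i/a_i in the normal rows, of d(x_i o f) in
    the tangential rows.\<close>
  define b where "b i j q = (if i \<in> S then coord_deriv U x j (a i) q / a i q
      else coord_deriv U x j (\<lambda>y. x (f y) $ i) q)" for i j q
  \<comment> \<open>Conversion to the logarithmic frame; the summand 1 stems from dx_i/x_i and
    therefore occurs in normal rows only.\<close>
  define J where "J q = (\<chi> i j. (if i = j \<and> i \<in> S then 1 else 0) + b i j q * (if j \<in> S then x q $ j else 1))" for q
  have b_hol: "hol_at A p (b i j)" for i j
  proof (cases "i \<in> S")
    case True
    then have "b i j = (\<lambda>q. coord_deriv U x j (a i) q / a i q)" by (simp add: b_def[abs_def])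
    then show ?thesis
      using hol_at_divide[OF hol_at_coord_deriv[OF a(1)] a(1) a(2), OF True True True] by simp
  next
    case False
    then have "b i j = coord_deriv U x j (\<lambda>y. x (f y) $ i)" by (simp add: b_def[abs_def])
    then show ?thesis
      using hol_at_coord_deriv[OF hol_at_comp[OF hol_at_coord]] by simp
  qed
  have "is_log_jacobian A f p U x S J"
    unfolding is_log_jacobian_def
  proof (intro conjI allI)
    fix i j
    have "hol_at A p (\<lambda>q. if j \<in> S then x q $ j else 1)"
      by (cases "j \<in> S") (simp_all add: hol_at_const hol_at_coord)
    then show "hol_at A p (\<lambda>q. J q $ i $ j)"
      unfolding J_def vec_lambda_beta by (intro hol_at_add[OF hol_at_const] hol_at_mult[OF b_hol])
  next
    have 1: "\<forall>\<^sub>F q in nhds p. \<forall>i\<in>S. x (f q) $ i = x q $ i * a i q"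
      by (rule eventually_ball_finite[OF finite]) (blast intro: fa)
    have 2: "\<forall>\<^sub>F q in nhds p. \<forall>i\<in>S. a i q \<noteq> 0"
    proof (rule eventually_ball_finite[OF finite], rule ballI)
      fix i assume "i \<in> S"
      then show "\<forall>\<^sub>F q in nhds p. a i q \<noteq> 0"
        by (intro eventually_nonzero a)
    qed
    \<comment> \<open>The product rule for x_i o f = x_i a_i, which holds on a neighbourhood and may
      thus be differentiated.\<close>
    have 3: "\<forall>\<^sub>F q in nhds p. \<forall>i\<in>S. \<forall>l. coord_deriv U x l (\<lambda>y. x (f y) $ i) q =
        (if l = i then a i q else 0) + x q $ i * coord_deriv U x l (a i) q"
    proof (rule eventually_ball_finite[OF finite], rule ballI, rule eventually_all_finite)
      fix i l assume i: "i \<in> S"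
      show "\<forall>\<^sub>F q in nhds p. coord_deriv U x l (\<lambda>y. x (f y) $ i) q =
        (if l = i then a i q else 0) + x q $ i * coord_deriv U x l (a i) q"
        using coord_deriv_cong[OF fa[OF i], of l] eventually_coord_deriv_mult[OF hol_at_coord a(1)[OF i], of l i]
          chart_at_eventually
      proof eventually_elim
        case (elim q)
        then show ?case
          using chart_at.coord_deriv_coord[OF elim(3), of l i] by simp
      qed
    qed
    show "\<forall>\<^sub>F q in nhds p. (\<forall>j\<in>S. x q $ j \<noteq> 0) \<longrightarrow>
        (\<forall>i. form_pullback U x f (log_frame x S i) q = (\<Sum>j\<in>UNIV. J q $ i $ j *s log_frame x S j q))"
      using 1 2 3
    proof eventually_elim
      case (elim q)
      show ?case
      proof (intro impI allI)
        fix i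
        assume nz: "\<forall>j\<in>S. x q $ j \<noteq> 0"
        have "form_pullback U x f (log_frame x S i) q $ l = (\<Sum>j\<in>UNIV. J q $ i $ j *s log_frame x S j q) $ l" for l
        proof (cases "i \<in> S")
          case True
          then have "form_pullback U x f (log_frame x S i) q $ l =
              1 / (x q $ i * a i q) * ((if l = i then a i q else 0) + x q $ i * coord_deriv U x l (a i) q)"
            using elim(1,3) by (simp add: form_pullback_log_frame_nth)
          also have "\<dots> = J q $ i $ l * (if l \<in> S then 1 / x q $ l else 1)"
            using True nz elim(2) by (auto simp: J_def b_def field_simps)
          finally show ?thesis by (simp only: log_frame_expansion_nth)
        next
          case False
          then show ?thesis
            unfolding form_pullback_log_frame_nth log_frame_expansion_nth using nz by (auto simp: J_def b_def)
        qed
        then show "form_pullback U x f (log_frame x S i) q = (\<Sum>j\<in>UNIV. J q $ i $ j *s log_frame x S j q)"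
          by (simp only: vec_eq_iff) simp
      qed
    qed
  qed
  then show log: "is_log_jacobian A f p U x S (log_jacobian A f p U x S)"
    unfolding log_jacobian_def by (rule someI[of "is_log_jacobian A f p U x S"])
  assume j: "j \<in> S"
  have "\<forall>\<^sub>F q in nhds p. log_jacobian A f p U x S q $ i $ j - (if i = j then 1 else 0) = b i j q * x q $ j"
    using is_log_jacobian_unique[OF log \<open>is_log_jacobian A f p U x S J\<close>, of i j]
  proof eventually_elim
    case (elim q)
    \<comment> \<open>For \<open>j\<close> in \<open>S\<close>, equality of \<open>i\<close> and
      \<open>j\<close> already puts \<open>i\<close> in \<open>S\<close>, so the restricted diagonal
      of \<open>J\<close> coincides with that of the identity.\<close>
    then show ?case using j by (auto simp: J_def)
  qed
  with b_hol show "\<exists>b. hol_at A p b \<and>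
      (\<forall>\<^sub>F q in nhds p. log_jacobian A f p U x S q $ i $ j - (if i = j then 1 else 0) = b q * x q $ j)"
    by blast
qed

end

theorem corollary6p4:
  fixes A :: "('a::t2_space, 'n::finite) atlas"
    and Ds :: "'a set set"
    and f :: "'a \<Rightarrow> 'a"
    and pr :: "'e \<Rightarrow> 'a"
    and r :: nat
    and T :: "('a, 'e) trivs"
    and \<Phi> :: "'a \<Rightarrow> 'e \<Rightarrow> 'e"
    and p :: 'a
    and k :: nat
    and x z :: "'a \<Rightarrow> complex ^ 'n"
    and U V W :: "'a set"
    and S :: "'n set"
    and \<psi> :: "'e \<Rightarrow> nat \<Rightarrow> complex"
  assumes "complex_manifold A"
    and "snc_divisor A Ds"
    and "strict_log_self_map A Ds f"
    and "holo_vector_bundle A r pr T"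
    and "linearisation A r pr T f \<Phi>"
    and "isolated_fixed_point f p"
    and "p \<in> \<Union>Ds"
    and "card {C \<in> Ds. p \<in> C} = k"
    and "centred_chart A p U x"
    and "adapted_chart A Ds p V z S"
    and "local_frame A r pr T W \<psi>" and "p \<in> W"
    and "normally_nonresonant A f p z S"
  shows "poly (boundary_index A r pr f \<Phi> p U x V z S \<psi>) (-1) = 0 \<and>
         [:1, 1:] ^ k dvd boundary_index A r pr f \<Phi> p U x V z S \<psi>"
proof -
  let ?J = "log_jacobian A f p V z S"
  let ?\<tau> = "frame_trace r pr \<psi> f \<Phi>"
  have z_centred: "centred_chart A p V z"
    using assms(10) by (simp add: adapted_chart_def)
  have f: "holo_self_map A f" "f p = p"
    using assms(3,6) by (simp_all add: strict_log_self_map_def isolated_fixed_point_def)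
  \<comment> \<open>\<open>X\<close> carries the residue and the ideal, \<open>Z\<close> the adapted
    coordinates and the logarithmic Jacobian; the base point and the map are the same.\<close>
  interpret X: fixed_point_chart A U x p f
    using assms(1,9) f by unfold_locales (simp_all add: centred_chart_def)
  interpret Z: fixed_point_chart A V z p f
    using assms(1) z_centred f by unfold_locales (simp_all add: centred_chart_def)
  obtain a where a: "\<And>i. i \<in> S \<Longrightarrow> hol_at A p (a i)" "\<And>i. i \<in> S \<Longrightarrow> a i p \<noteq> 0"
    "\<And>i. i \<in> S \<Longrightarrow> \<forall>\<^sub>F q in nhds p. z (f q) $ i = z q $ i * a i q"
    and nonres: "(\<Prod>i\<in>S. 1 - a i p) \<noteq> 0"
    using assms(13) unfolding normally_nonresonant_def by blast
  have z_ideal: "(\<lambda>q. z q $ j) \<in> X.fix_ideal" if j: "j \<in> S" for j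
  proof -
    \<comment> \<open>A nonzero product has no zero factor, so non-resonance makes every single 1 -
      a_j a unit at \<open>p\<close>.\<close>
    have unit: "hol_at A p (\<lambda>q. 1 - a j q)" "1 - a j p \<noteq> 0"
      using nonres j X.hol_at_diff[OF X.hol_at_const a(1)] by auto
    have "(\<lambda>q. 1 / (1 - a j q) * (z q $ j - z (f q) $ j)) \<in> X.fix_ideal"
      by (intro X.fix_ideal_mult X.hol_at_divide X.hol_at_const unit X.diff_comp_in_fix_ideal Z.hol_at_coord)
    moreover have "\<forall>\<^sub>F q in nhds p. 1 / (1 - a j q) * (z q $ j - z (f q) $ j) = z q $ j"
      using a(3)[OF j] X.eventually_nonzero[OF unit]
    proof eventually_elim
      case (elim q)
      have "z q $ j - z (f q) $ j = (1 - a j q) * z q $ j"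
        unfolding elim(1) by (simp add: algebra_simps)
      with elim(2) show ?case by simp
    qed
    ultimately show ?thesis by (rule X.fix_ideal_cong)
  qed
  have J_hol: "hol_at A p (\<lambda>q. ?J q $ i $ j)" for i j
    using Z.log_jacobian_near_identity(1)[OF a] by (simp add: is_log_jacobian_def)
  have J_ideal: "(\<lambda>q. ?J q $ i $ j - (if i = j then 1 else 0)) \<in> X.fix_ideal" if j: "j \<in> S" for i j
  proof -
    obtain b where b: "hol_at A p b"
      "\<forall>\<^sub>F q in nhds p. ?J q $ i $ j - (if i = j then 1 else 0) = b q * z q $ j"
      using Z.log_jacobian_near_identity(2)[OF a j] by blast
    have "\<forall>\<^sub>F q in nhds p. b q * z q $ j = ?J q $ i $ j - (if i = j then 1 else 0)"
      using b(2) by eventually_elim (rule sym)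
    with X.fix_ideal_mult[OF b(1) z_ideal[OF j]] show ?thesis
      by (rule X.fix_ideal_cong)
  qed
  have \<tau>: "hol_at A p ?\<tau>"
    by (rule X.hol_at_frame_trace[OF assms(4,5,11,12)])
  have "hol_at A p (\<lambda>q. ?\<tau> q * coeff (det_one_plus (?J q)) d)" for d
    using X.poly_hol_det_one_plus[of ?J, OF J_hol] by (intro X.hol_at_mult \<tau>) (simp add: X.poly_hol_def)
  then have index: "boundary_index A r pr f \<Phi> p U x V z S \<psi> =
      (\<Sum>d\<le>CARD('n). monom (X.residue (\<lambda>q. ?\<tau> q * coeff (det_one_plus (?J q)) d)) d)"
    by (simp add: boundary_index_def X.residue_functional_fixed_class)
  \<comment> \<open>Adaptedness matches the branches through \<open>p\<close> with the normal
    directions, which converts \<open>card S\<close> into the number of branches and, as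
    \<open>p\<close> lies on some branch, makes it positive.\<close>
  obtain \<sigma> where "bij_betw \<sigma> {C \<in> Ds. p \<in> C} S"
    using assms(10) unfolding adapted_chart_def by blast
  then have k: "card S = k"
    using assms(8) bij_betw_same_card by metis
  have "S \<noteq> {}"
    using \<open>bij_betw \<sigma> {C \<in> Ds. p \<in> C} S\<close> assms(7) by (auto simp: bij_betw_def)
  then have "k \<noteq> 0"
    unfolding k[symmetric] by simp
  have dvd: "[:1, 1:] ^ k dvd boundary_index A r pr f \<Phi> p U x V z S \<psi>"
    unfolding index k[symmetric] by (rule X.residue_det_one_plus_dvd[OF \<tau> J_hol J_ideal])
  moreover from this have "[:1, 1:] dvd boundary_index A r pr f \<Phi> p U x V z S \<psi>"
    using \<open>k \<noteq> 0\<close> dvd_power[of k "[:1, 1:] :: complex poly"] dvd_trans by blast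
  \<comment> \<open>\<open>[:1, 1:]\<close> is the linear factor 1 + y belonging to the root
    -1.\<close>
  ultimately show ?thesis
    by (simp add: poly_eq_0_iff_dvd)
qed

end
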